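(* Assume $1<p<D_w$, let $q=\frac{D_wp}{D_w-p}$, and assume the global weighted Sobolev inequality holds on $\Omega$: there is $S_{p,w}>0$ with $$S_{p,w}\Big(\int_\Omega|u|^qw\,dx\Big)^{1/q}\le\Big(\int_\Omega|\nabla u|^pw\,dx\Big)^{1/p}\quad\forall u\in C_c^\infty(\Omega).$$ If $u\in D^{1,p,w}(\Omega)$ is a weak solution of $-\operatorname{div}(w|\nabla u|^{p-2}\nabla u)=w|u|^{q-2}u$ in $\Omega$, then there exist $R>0$, $C>0$ and $\lambda>0$ such that $$|u(x)|\le\frac{C}{|x|^{\frac{D_w-p}{p}+\lambda}}\qquad\text{for (a.e.) }x\in\Omega\text{ with }|x|\ge R.$$
   Context: Let $\Omega\subseteq\mathbb R^N$ be open and $1<p<\infty$. A weight is a function $w\in L^1_{loc}(\Omega)$ with $0<w<\infty$ Lebesgue-a.e.; write $w(E)=\int_E w\,dx$. Standing assumptions on $w$: (i) doubling: there is $\gamma>0$ with $w(2B)\le\gamma\,w(B)$ for every ball $B$ with $2B\subset\Omega$ ($2B$ is the concentric ball of double radius); $\gamma_w$ denotes the smallest such $\gamma$; (ii) local weighted $(1,p)$-Poincaré inequality: there are $C_1>0$, $\rho\ge1$ such that for all $u\in C^1(\Omega)$ and balls $B$ of radius $l(B)$ with $\rho B\subset\Omega$, $w(B)^{-1}\int_B|u-u_{B,w}|w\le C_1 l(B)\big(w(\rho B)^{-1}\int_{\rho B}|\nabla u|^pw\big)^{1/p}$, where $u_{B,w}=w(B)^{-1}\int_B uw$. The dimension of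 $w$ is $D_w:=\log_2\gamma_w$. $D^{1,p,w}(\Omega)$ is the closure of $C_c^\infty(\Omega)$ under the (semi)norm $\|\nabla u\|_{L^{p,w}(\Omega)}=(\int_\Omega|\nabla u|^pw)^{1/p}$. A weak solution $u\in D^{1,p,w}(\Omega)$ of $-\operatorname{div}(w|\nabla u|^{p-2}\nabla u)=w|u|^{q-2}u$ satisfies $\int_\Omega|\nabla u|^{p-2}\nabla u\cdot\nabla\varphi\,w\,dx=\int_\Omega|u|^{q-2}u\varphi\,w\,dx$ for all $\varphi\in D^{1,p,w}(\Omega)$. *)

theory Defs
  imports "HOL-Analysis.Analysis"
begin

definition grad :: "('a::euclidean_space \<Rightarrow> real) \<Rightarrow> 'a \<Rightarrow> 'a" where
  "grad f x = (\<Sum>i\<in>Basis. frechet_derivative f (at x) i *\<^sub>R i)"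

fun iter_deriv :: "'a::euclidean_space list \<Rightarrow> ('a \<Rightarrow> real) \<Rightarrow> 'a \<Rightarrow> real" where
  "iter_deriv [] f = f"
| "iter_deriv (v # vs) f = (\<lambda>x. frechet_derivative (iter_deriv vs f) (at x) v)"

definition smooth_on :: "'a::euclidean_space set \<Rightarrow> ('a \<Rightarrow> real) \<Rightarrow> bool" where
  "smooth_on S f \<longleftrightarrow> (\<forall>vs. iter_deriv vs f differentiable_on S)"

definition C1_on :: "'a::euclidean_space set \<Rightarrow> ('a \<Rightarrow> real) \<Rightarrow> bool" where
  "C1_on S f \<longleftrightarrow> f differentiable_on S \<and> continuous_on S (grad f)"

definition test_fun :: "'a::euclidean_space set \<Rightarrow> ('a \<Rightarrow> real) \<Rightarrow> bool" where
  "test_fun \<Omega> \<phi> \<longleftrightarrow> smooth_on \<Omega> \<phi> \<and> compact (closure {x. \<phi> x \<noteq> 0})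
      \<and> closure {x. \<phi> x \<noteq> 0} \<subseteq> \<Omega>"

definition wmeas :: "('a::euclidean_space \<Rightarrow> real) \<Rightarrow> 'a set \<Rightarrow> ennreal" where
  "wmeas w E = (\<integral>\<^sup>+ x. ennreal (w x) * indicator E x \<partial>lebesgue)"

definition is_weight :: "'a::euclidean_space set \<Rightarrow> ('a \<Rightarrow> real) \<Rightarrow> bool" where
  "is_weight \<Omega> w \<longleftrightarrow> w \<in> borel_measurable lebesgue
     \<and> (\<forall>K. compact K \<and> K \<subseteq> \<Omega> \<longrightarrow> set_integrable lebesgue K w)
     \<and> (AE x in lebesgue. x \<in> \<Omega> \<longrightarrow> 0 < w x)"

definition doubling_const :: "'a::euclidean_space set \<Rightarrow> ('a \<Rightarrow> real) \<Rightarrow> real \<Rightarrow> bool" where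
  "doubling_const \<Omega> w \<gamma> \<longleftrightarrow> \<gamma> > 0 \<and>
     (\<forall>x r. r > 0 \<and> ball x (2 * r) \<subseteq> \<Omega> \<longrightarrow>
        wmeas w (ball x (2 * r)) \<le> ennreal \<gamma> * wmeas w (ball x r))"

definition doubling :: "'a::euclidean_space set \<Rightarrow> ('a \<Rightarrow> real) \<Rightarrow> bool" where
  "doubling \<Omega> w \<longleftrightarrow> (\<exists>\<gamma>. doubling_const \<Omega> w \<gamma>)"

definition gamma_w :: "'a::euclidean_space set \<Rightarrow> ('a \<Rightarrow> real) \<Rightarrow> real" where
  "gamma_w \<Omega> w = Inf {\<gamma>. doubling_const \<Omega> w \<gamma>}"

definition dim_w :: "'a::euclidean_space set \<Rightarrow> ('a \<Rightarrow> real) \<Rightarrow> real" where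
  "dim_w \<Omega> w = log 2 (gamma_w \<Omega> w)"

text \<open>Local weighted (1,p)-Poincare inequality.  The inequality is required whenever
  its ingredients are finite (if the right-hand side is infinite it holds trivially).\<close>
definition poincare :: "'a::euclidean_space set \<Rightarrow> ('a \<Rightarrow> real) \<Rightarrow> real \<Rightarrow> bool" where
  "poincare \<Omega> w p \<longleftrightarrow> (\<exists>C1 \<rho>. C1 > 0 \<and> \<rho> \<ge> 1 \<and>
     (\<forall>u x r. C1_on \<Omega> u \<and> r > 0 \<and> ball x (\<rho> * r) \<subseteq> \<Omega>
        \<and> wmeas w (ball x (\<rho> * r)) < \<infinity>
        \<and> set_integrable lebesgue (ball x r) (\<lambda>y. u y * w y)
        \<and> set_integrable lebesgue (ball x (\<rho> * r)) (\<lambda>y. norm (grad u y) powr p * w y)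
        \<longrightarrow> (let wB = enn2real (wmeas w (ball x r));
                 wrB = enn2real (wmeas w (ball x (\<rho> * r)));
                 uB = (LINT y:ball x r|lebesgue. u y * w y) / wB
             in (LINT y:ball x r|lebesgue. \<bar>u y - uB\<bar> * w y) / wB
                \<le> C1 * r * ((LINT y:ball x (\<rho> * r)|lebesgue. norm (grad u y) powr p * w y) / wrB)
                             powr (1 / p))))"

definition sobolev_ineq :: "'a::euclidean_space set \<Rightarrow> ('a \<Rightarrow> real) \<Rightarrow> real \<Rightarrow> real \<Rightarrow> bool" where
  "sobolev_ineq \<Omega> w p q \<longleftrightarrow> (\<exists>S. S > 0 \<and> (\<forall>u. test_fun \<Omega> u \<longrightarrow>
     S * (LINT x:\<Omega>|lebesgue. \<bar>u x\<bar> powr q * w x) powr (1 / q)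
       \<le> (LINT x:\<Omega>|lebesgue. norm (grad u x) powr p * w x) powr (1 / p)))"

text \<open>Elements of D^{1,p,w}(Omega), realised as pairs (u, G) of a function and its gradient:
  there are test functions phi_k with grad phi_k \<rightarrow> G in L^{p,w}(Omega) and phi_k \<rightarrow> u a.e. in Omega.\<close>
definition D1pw :: "'a::euclidean_space set \<Rightarrow> ('a \<Rightarrow> real) \<Rightarrow> real \<Rightarrow> ('a \<Rightarrow> real) \<Rightarrow> ('a \<Rightarrow> 'a) \<Rightarrow> bool" where
  "D1pw \<Omega> w p u G \<longleftrightarrow> u \<in> borel_measurable lebesgue \<and> G \<in> borel_measurable lebesgue \<and>
     (\<exists>\<phi>. (\<forall>k. test_fun \<Omega> (\<phi> k))
        \<and> (\<lambda>k. \<integral>\<^sup>+ x. ennreal (norm (grad (\<phi> k) x - G x) powr p * w x) * indicator \<Omega> x \<partial>lebesgue)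
             \<longlonglongrightarrow> 0
        \<and> (AE x in lebesgue. x \<in> \<Omega> \<longrightarrow> (\<lambda>k. \<phi> k x) \<longlonglongrightarrow> u x))"

definition weak_solution :: "'a::euclidean_space set \<Rightarrow> ('a \<Rightarrow> real) \<Rightarrow> real \<Rightarrow> real \<Rightarrow> ('a \<Rightarrow> real) \<Rightarrow> ('a \<Rightarrow> 'a) \<Rightarrow> bool" where
  "weak_solution \<Omega> w p q u G \<longleftrightarrow> D1pw \<Omega> w p u G \<and>
     (\<forall>\<phi> G\<phi>. D1pw \<Omega> w p \<phi> G\<phi> \<longrightarrow>
        (LINT x:\<Omega>|lebesgue. norm (G x) powr (p - 2) * (G x \<bullet> G\<phi> x) * w x)
        = (LINT x:\<Omega>|lebesgue. \<bar>u x\<bar> powr (q - 2) * u x * \<phi> x * w x))"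

end

theory Submission
  imports Defs
begin

text \<open>
  Write \<open>D = dim_w \<Omega> w\<close>. Two global estimates give the decay.

  First, testing with \<open>u (u\<^sup>2 + c) powr (- 1/4)\<close> and letting \<open>c\<close> tend to \<open>0\<close> shows that \<open>u\<close> is in
  \<open>L\<^sup>s(w)\<close> for some \<open>s < q\<close>: the critical right-hand side is absorbed where \<open>u\<close> is small.

  Second, compare \<open>u\<close> with the barrier \<open>g(x) = k (1 + \<bar>x\<bar>\<^sup>2) powr (- \<kappa>/2)\<close>. Its logarithmic gradient is
  at most \<open>\<kappa> (g/k) powr (1/\<kappa>)\<close>, so that on \<open>{\<bar>u\<bar> \<ge> g}\<close> the error \<open>(\<bar>u\<bar> \<bar>\<nabla>g\<bar>/g) powr p\<close> is bounded by a
  multiple of \<open>\<bar>u\<bar> powr (p + p/\<kappa>)\<close>: the barrier replaces cut-off functions and volume bounds. For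
  \<open>\<kappa> = (D - p)/p\<close> the exponent \<open>p + p/\<kappa>\<close> equals \<open>q\<close>; for slightly larger \<open>\<kappa>\<close> it lies in \<open>(s, q)\<close> and
  Hoelder's inequality applies. A De Giorgi iteration then gives \<open>\<bar>u\<bar> \<le> g\<close> for large \<open>k\<close>. The truncations
  are smooth: the indicator of \<open>{\<bar>u\<bar> \<ge> g}\<close> is replaced by \<open>a/(1 + a)\<close> with \<open>a = (u/g) ^ (2 m)\<close>, and the
  iteration lets \<open>m\<close> grow geometrically instead of raising the level.
\<close>

section \<open>Smooth functions and test functions\<close>

text \<open>The two estimates have different tasks. At the critical rate (D - p)/p the barrier error
  has the exponent \<open>q\<close>, and the iteration would close with the L^q bound alone. A
  strictly positive \<open>lam\<close> forces an exponent below \<open>q\<close>, and that is what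
  the integrability below \<open>q\<close> pays for. Hoelder's inequality costs a power: the
  recursion carries \<open>Y powr \<tau>\<close>, which Sobolev's inequality raises to
  \<open>q / p\<close>, so it is superlinear exactly when \<tau> > p/q. The obstacle is the energy
  space: its members are known only as limits of smooth, compactly supported functions. Each test
  function built from \<open>u\<close> must therefore be the limit of the same smooth expression in
  the approximants. The energy estimate bounds an integral with \<open>h powr q\<close> by integrals
  with the larger factor \<open>h\<close>. Since \<open>soft_step (m * Q)\<close> is at most 2^Q
  times the Q-th power of \<open>soft_step m\<close>, passing from m to m Q recovers the lost power.
  The price is a constant polynomial in m, hence geometric in the iteration index, which a
  superlinear recursion tolerates.\<close>

lemma GDERIV_grad:
  assumes "GDERIV f x :> D"
  shows "grad f x = D"
proof -
  have "frechet_derivative f (at x) = (\<lambda>h. h \<bullet> D)"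
    using assms unfolding gderiv_def by (metis frechet_derivative_at)
  then show ?thesis
    unfolding grad_def by (simp add: inner_commute[of _ D] euclidean_representation)
qed

lemma differentiable_GDERIV:
  fixes f :: "'a::euclidean_space \<Rightarrow> real"
  assumes "f differentiable at x"
  shows "GDERIV f x :> grad f x"
proof -
  let ?D = "frechet_derivative f (at x)"
  have D: "(f has_derivative ?D) (at x)"
    using assms frechet_derivative_works by blast
  then have "linear ?D"
    using has_derivative_bounded_linear bounded_linear.linear by blast
  have "?D h = h \<bullet> grad f x" for h
  proof -
    have "?D h = ?D (\<Sum>i\<in>Basis. (h \<bullet> i) *\<^sub>R i)"
      by (simp add: euclidean_representation)
    also have "\<dots> = (\<Sum>i\<in>Basis. (h \<bullet> i) * ?D i)"
      using \<open>linear ?D\<close> by (simp add: linear_sum linear_scale)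
    also have "\<dots> = h \<bullet> grad f x"
      unfolding grad_def by (simp add: inner_sum_right mult.commute)
    finally show ?thesis .
  qed
  then show ?thesis
    using D unfolding gderiv_def by (metis (no_types, lifting) ext)
qed

lemma GDERIV_differentiable: "GDERIV f x :> D \<Longrightarrow> f differentiable at x"
  unfolding gderiv_def differentiable_def by blast

lemma GDERIV_cong_open:
  assumes "open S" "x \<in> S" "\<And>y. y \<in> S \<Longrightarrow> f y = g y" "GDERIV f x :> D"
  shows "GDERIV g x :> D"
  using assms has_derivative_transform_within_open[of f _ x UNIV S g] unfolding gderiv_def by auto

text \<open>A coinduction principle: if a class contains all directional derivatives of its members,
  induction on the list of directions keeps every iterated derivative in it. Agreement on
  \<open>S\<close> is enough because \<open>S\<close> is open and derivatives are local; the
  arbitrary values of \<open>frechet_derivative\<close> elsewhere do no harm.\<close>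

lemma smooth_on_family:
  fixes S :: "'a::euclidean_space set" and \<F> :: "('a \<Rightarrow> real) set"
  assumes S: "open S"
    and D: "\<And>f. f \<in> \<F> \<Longrightarrow>
      \<exists>g. (\<forall>x\<in>S. GDERIV f x :> g x) \<and> (\<forall>v. \<exists>h\<in>\<F>. \<forall>x\<in>S. h x = v \<bullet> g x)"
    and f: "f \<in> \<F>"
  shows "smooth_on S f"
proof -
  have *: "\<exists>h\<in>\<F>. \<forall>x\<in>S. iter_deriv vs f x = h x" for vs
  proof (induction vs)
    case Nil
    then show ?case using f by auto
  next
    case (Cons v vs)
    then obtain h where h: "h \<in> \<F>" "\<And>x. x \<in> S \<Longrightarrow> iter_deriv vs f x = h x" by blast
    obtain g k where g: "\<And>x. x \<in> S \<Longrightarrow> GDERIV h x :> g x"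
      and k: "k \<in> \<F>" "\<And>x. x \<in> S \<Longrightarrow> k x = v \<bullet> g x"
      using D[OF h(1)] by blast
    have "iter_deriv (v # vs) f x = k x" if "x \<in> S" for x
    proof -
      have "GDERIV (iter_deriv vs f) x :> g x"
        using GDERIV_cong_open[OF S that _ g[OF that]] h(2) by simp
      then have "frechet_derivative (iter_deriv vs f) (at x) = (\<lambda>h. h \<bullet> g x)"
        unfolding gderiv_def by (metis frechet_derivative_at)
      then show ?thesis using k(2)[OF that] by simp
    qed
    then show ?case using k(1) by blast
  qed
  show ?thesis
    unfolding smooth_on_def
  proof (intro allI)
    fix vs
    obtain h where h: "h \<in> \<F>" "\<And>x. x \<in> S \<Longrightarrow> iter_deriv vs f x = h x" using * by blast
    obtain g where g: "\<And>x. x \<in> S \<Longrightarrow> GDERIV h x :> g x" using D[OF h(1)] by blast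
    have "iter_deriv vs f differentiable at x" if "x \<in> S" for x
      using GDERIV_cong_open[OF S that _ g[OF that]] h(2) GDERIV_differentiable by metis
    then show "iter_deriv vs f differentiable_on S"
      using differentiable_at_imp_differentiable_on by blast
  qed
qed

text \<open>Closing under products and real powers as well makes the class stable under differentiation.\<close>
inductive_set smooth_alg :: "'a::euclidean_space set \<Rightarrow> ('a \<Rightarrow> real) set" for S where
  base: "smooth_on S f \<Longrightarrow> f \<in> smooth_alg S"
| add: "f \<in> smooth_alg S \<Longrightarrow> g \<in> smooth_alg S \<Longrightarrow> (\<lambda>x. f x + g x) \<in> smooth_alg S"
| mult: "f \<in> smooth_alg S \<Longrightarrow> g \<in> smooth_alg S \<Longrightarrow> (\<lambda>x. f x * g x) \<in> smooth_alg S"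
| powr: "f \<in> smooth_alg S \<Longrightarrow> (\<And>x. x \<in> S \<Longrightarrow> f x > 0) \<Longrightarrow> (\<lambda>x. f x powr a) \<in> smooth_alg S"

lemma smooth_on_const: "smooth_on (S::'a::euclidean_space set) (\<lambda>x. c)"
proof -
  have *: "\<exists>c'. iter_deriv vs (\<lambda>x::'a. c) = (\<lambda>x. c')" for vs
    by (induction vs) auto
  have "iter_deriv vs (\<lambda>x::'a. c) differentiable_on S" for vs
    using *[of vs] by auto
  then show ?thesis unfolding smooth_on_def by blast
qed

lemma smooth_on_inner: "smooth_on (S::'a::euclidean_space set) (\<lambda>x. x \<bullet> c)"
proof -
  have *: "(\<exists>c'. iter_deriv vs (\<lambda>x::'a. x \<bullet> c) = (\<lambda>x. c')) \<or> iter_deriv vs (\<lambda>x::'a. x \<bullet> c) = (\<lambda>x. x \<bullet> c)" for vs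
  proof (induction vs)
    case (Cons v vs)
    have "frechet_derivative (\<lambda>x. x \<bullet> c) (at x) = (\<lambda>x. x \<bullet> c)" for x :: 'a
      by (metis bounded_linear_inner_left bounded_linear_imp_has_derivative frechet_derivative_at)
    with Cons show ?case by auto
  qed simp
  have "(\<lambda>x::'a. x \<bullet> c) differentiable_on S"
    by (simp add: bounded_linear_inner_left bounded_linear_imp_differentiable_on)
  then have "iter_deriv vs (\<lambda>x::'a. x \<bullet> c) differentiable_on S" for vs
    using *[of vs] by auto
  then show ?thesis unfolding smooth_on_def by blast
qed

lemma smooth_on_directional:
  assumes S: "open S" and f: "smooth_on S f"
  shows "\<forall>x\<in>S. GDERIV f x :> grad f x" and "\<exists>h. smooth_on S h \<and> (\<forall>x\<in>S. h x = v \<bullet> grad f x)"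
proof -
  have "f differentiable_on S"
    using f[unfolded smooth_on_def, rule_format, of "[]"] by simp
  then show *: "\<forall>x\<in>S. GDERIV f x :> grad f x"
    using S differentiable_GDERIV differentiable_on_eq_differentiable_at by blast
  \<comment> \<open>\<open>iter_deriv\<close> differentiates in the last listed direction first, so
    a directional derivative of \<open>f\<close> appends its direction at the end of the
    list.\<close>
  have i: "iter_deriv vs (\<lambda>x. frechet_derivative f (at x) v) = iter_deriv (vs @ [v]) f" for vs
    by (induction vs) auto
  have "smooth_on S (\<lambda>x. frechet_derivative f (at x) v)"
    using f unfolding smooth_on_def i by blast
  moreover have "frechet_derivative f (at x) v = v \<bullet> grad f x" if "x \<in> S" for x
    using * that unfolding gderiv_def by (metis frechet_derivative_at)
  ultimately show "\<exists>h. smooth_on S h \<and> (\<forall>x\<in>S. h x = v \<bullet> grad f x)" by blast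
qed

text \<open>By rule induction, each member has a gradient whose components again lie in the algebra.
  For \<open>powr\<close> the exponent drops to \<open>a - 1\<close>, which is why the algebra
  admits every real exponent over a positive base.\<close>

lemma smooth_alg_smooth:
  assumes S: "open S" and f: "f \<in> smooth_alg S"
  shows "smooth_on S f"
proof (rule smooth_on_family[OF S _ f])
  fix f assume "f \<in> smooth_alg S"
  then show "\<exists>g. (\<forall>x\<in>S. GDERIV f x :> g x) \<and> (\<forall>v. \<exists>h\<in>smooth_alg S. \<forall>x\<in>S. h x = v \<bullet> g x)"
  proof induction
    case (base f)
    have "\<exists>h\<in>smooth_alg S. \<forall>x\<in>S. h x = v \<bullet> grad f x" for v
      using smooth_on_directional(2)[OF S base, of v] smooth_alg.base by auto
    then show ?case using smooth_on_directional(1)[OF S base] by (intro exI[of _ "grad f"]) blast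
  next
    case (add f1 f2)
    obtain g1 where g1: "(\<forall>x\<in>S. GDERIV f1 x :> g1 x) \<and> (\<forall>v. \<exists>h\<in>smooth_alg S. \<forall>x\<in>S. h x = v \<bullet> g1 x)"
      using add.IH(1) by (rule exE)
    obtain g2 where g2: "(\<forall>x\<in>S. GDERIV f2 x :> g2 x) \<and> (\<forall>v. \<exists>h\<in>smooth_alg S. \<forall>x\<in>S. h x = v \<bullet> g2 x)"
      using add.IH(2) by (rule exE)
    have "\<exists>h\<in>smooth_alg S. \<forall>x\<in>S. h x = v \<bullet> (g1 x + g2 x)" for v
    proof -
      obtain h1 where h1: "h1 \<in> smooth_alg S" "\<forall>x\<in>S. h1 x = v \<bullet> g1 x" using g1 by meson
      obtain h2 where h2: "h2 \<in> smooth_alg S" "\<forall>x\<in>S. h2 x = v \<bullet> g2 x" using g2 by meson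
      show ?thesis
        using h1 h2 smooth_alg.add[OF h1(1) h2(1)]
        by (intro bexI[of _ "\<lambda>x. h1 x + h2 x"]) (auto simp: inner_add_right)
    qed
    then show ?case using g1 g2 by (intro exI[of _ "\<lambda>x. g1 x + g2 x"]) (auto intro: GDERIV_add)
  next
    case (mult f1 f2)
    obtain g1 where g1: "(\<forall>x\<in>S. GDERIV f1 x :> g1 x) \<and> (\<forall>v. \<exists>h\<in>smooth_alg S. \<forall>x\<in>S. h x = v \<bullet> g1 x)"
      using mult.IH(1) by (rule exE)
    obtain g2 where g2: "(\<forall>x\<in>S. GDERIV f2 x :> g2 x) \<and> (\<forall>v. \<exists>h\<in>smooth_alg S. \<forall>x\<in>S. h x = v \<bullet> g2 x)"
      using mult.IH(2) by (rule exE)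
    have "\<exists>h\<in>smooth_alg S. \<forall>x\<in>S. h x = v \<bullet> (f1 x *\<^sub>R g2 x + f2 x *\<^sub>R g1 x)" for v
    proof -
      obtain h1 where h1: "h1 \<in> smooth_alg S" "\<forall>x\<in>S. h1 x = v \<bullet> g1 x" using g1 by meson
      obtain h2 where h2: "h2 \<in> smooth_alg S" "\<forall>x\<in>S. h2 x = v \<bullet> g2 x" using g2 by meson
      show ?thesis
        using h1 h2 smooth_alg.add[OF smooth_alg.mult[OF mult(1) h2(1)] smooth_alg.mult[OF mult(2) h1(1)]]
        by (intro bexI[of _ "\<lambda>x. f1 x * h2 x + f2 x * h1 x"]) (auto simp: inner_add_right)
    qed
    then show ?case
      using g1 g2 by (intro exI[of _ "\<lambda>x. f1 x *\<^sub>R g2 x + f2 x *\<^sub>R g1 x"]) (auto intro: GDERIV_mult)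
  next
    case (powr f1 a)
    obtain g1 where g1: "(\<forall>x\<in>S. GDERIV f1 x :> g1 x) \<and> (\<forall>v. \<exists>h\<in>smooth_alg S. \<forall>x\<in>S. h x = v \<bullet> g1 x)"
      using powr.IH by (rule exE)
    let ?g = "\<lambda>x. (a * f1 x powr (a - 1)) *\<^sub>R g1 x"
    have "GDERIV (\<lambda>x. f1 x powr a) x :> ?g x" if "x \<in> S" for x
      using GDERIV_DERIV_compose[of f1 x "g1 x" "\<lambda>y. y powr a" "a * f1 x powr (a - 1)"]
        g1 powr(2)[OF that] that has_real_derivative_powr by auto
    moreover have "\<exists>h\<in>smooth_alg S. \<forall>x\<in>S. h x = v \<bullet> ?g x" for v
    proof -
      obtain h1 where h1: "h1 \<in> smooth_alg S" "\<forall>x\<in>S. h1 x = v \<bullet> g1 x" using g1 by meson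
      have "(\<lambda>x. (a * f1 x powr (a - 1)) * h1 x) \<in> smooth_alg S"
        by (intro smooth_alg.mult smooth_alg.powr powr(1,2) h1(1) smooth_alg.base smooth_on_const)
      with h1(2) show ?thesis by (intro bexI[of _ "\<lambda>x. (a * f1 x powr (a - 1)) * h1 x"]) auto
    qed
    ultimately show ?case by (intro exI[of _ ?g]) blast
  qed
qed

lemma smooth_alg_const: "(\<lambda>x. c) \<in> smooth_alg S"
  by (rule smooth_alg.base[OF smooth_on_const])

lemma smooth_alg_diff:
  assumes "f \<in> smooth_alg S" "g \<in> smooth_alg S"
  shows "(\<lambda>x. f x - g x) \<in> smooth_alg S"
  using smooth_alg.add[OF assms(1) smooth_alg.mult[OF smooth_alg_const[of "-1"] assms(2)]] by simp

lemma smooth_alg_power: "f \<in> smooth_alg S \<Longrightarrow> (\<lambda>x. f x ^ n) \<in> smooth_alg S"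
  by (induction n) (auto intro: smooth_alg_const smooth_alg.mult)

lemma smooth_alg_sum:
  assumes "\<And>i. i \<in> I \<Longrightarrow> f i \<in> smooth_alg S"
  shows "(\<lambda>x. \<Sum>i\<in>I. f i x) \<in> smooth_alg S"
  using assms by (induction I rule: infinite_finite_induct) (auto intro: smooth_alg_const smooth_alg.add)

lemma smooth_alg_inner_self: "(\<lambda>x. x \<bullet> x) \<in> smooth_alg S"
proof -
  have "(\<lambda>x::'a. \<Sum>i\<in>Basis. (x \<bullet> i) * (x \<bullet> i)) \<in> smooth_alg S"
    by (intro smooth_alg_sum smooth_alg.mult smooth_alg.base smooth_on_inner)
  moreover have "(\<lambda>x::'a. \<Sum>i\<in>Basis. (x \<bullet> i) * (x \<bullet> i)) = (\<lambda>x. x \<bullet> x)"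
    by (rule ext) (rule euclidean_inner[symmetric])
  ultimately show ?thesis by simp
qed

section \<open>Calculus of test functions\<close>

lemma test_fun_GDERIV:
  assumes "open \<Omega>" "test_fun \<Omega> \<phi>"
  shows "GDERIV \<phi> x :> grad \<phi> x"
proof (cases "x \<in> \<Omega>")
  case True
  then show ?thesis
    using assms smooth_on_directional(1) unfolding test_fun_def by blast
next
  case False
  \<comment> \<open>A point outside \<Omega> has a whole neighbourhood off the closed support, where
    \<phi> is 0; test functions are thus differentiable on the entire space.\<close>
  let ?U = "- closure {x. \<phi> x \<noteq> 0}"
  have x: "x \<in> ?U" using False assms(2) unfolding test_fun_def by blast
  have "GDERIV \<phi> x :> 0"
  proof (rule GDERIV_cong_open[OF _ x, of "\<lambda>x. 0"])
    show "0 = \<phi> y" if "y \<in> ?U" for y using that closure_subset[of "{x. \<phi> x \<noteq> 0}"] by auto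
  qed (auto intro: GDERIV_const)
  then show ?thesis using GDERIV_grad by metis
qed

lemma test_fun_grad_0:
  assumes "x \<notin> closure {x. \<phi> x \<noteq> 0}"
  shows "grad \<phi> x = 0"
proof (rule GDERIV_grad, rule GDERIV_cong_open[of "- closure {x. \<phi> x \<noteq> 0}" _ "\<lambda>x. 0"])
  show "0 = \<phi> y" if "y \<in> - closure {x. \<phi> x \<noteq> 0}" for y
    using that closure_subset[of "{x. \<phi> x \<noteq> 0}"] by auto
qed (use assms in \<open>auto intro: GDERIV_const\<close>)

lemma test_fun_continuous:
  assumes "open \<Omega>" "test_fun \<Omega> \<phi>"
  shows "continuous_on UNIV \<phi>" "continuous_on UNIV (grad \<phi>)"
proof -
  show "continuous_on UNIV \<phi>"
    using differentiable_imp_continuous_within[OF GDERIV_differentiable[OF test_fun_GDERIV[OF assms]]]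
    by (simp add: continuous_at_imp_continuous_on)
  have *: "continuous_on \<Omega> (grad \<phi>)"
    unfolding grad_def
  proof (intro continuous_intros)
    fix i :: 'a
    have "iter_deriv [i] \<phi> differentiable_on \<Omega>"
      using assms(2) unfolding test_fun_def smooth_on_def by blast
    then show "continuous_on \<Omega> (\<lambda>x. frechet_derivative \<phi> (at x) i)"
      by (simp add: differentiable_imp_continuous_on)
  qed
  \<comment> \<open>\<Omega> and the complement of the support are open and cover the space, so
    continuity of the gradient can be glued.\<close>
  have "continuous_on (- closure {x. \<phi> x \<noteq> 0}) (grad \<phi>) = continuous_on (- closure {x. \<phi> x \<noteq> 0}) (\<lambda>x. 0::'a)"
    by (rule continuous_on_cong) (auto simp: test_fun_grad_0)
  then have "continuous_on (\<Omega> \<union> - closure {x. \<phi> x \<noteq> 0}) (grad \<phi>)"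
    using * assms(1) by (intro continuous_on_open_Un) auto
  moreover have "\<Omega> \<union> - closure {x. \<phi> x \<noteq> 0} = UNIV"
    using assms(2) unfolding test_fun_def by blast
  ultimately show "continuous_on UNIV (grad \<phi>)" by simp
qed

lemma test_funI:
  assumes "smooth_on \<Omega> f" "{x. f x \<noteq> 0} \<subseteq> K" "compact K" "K \<subseteq> \<Omega>"
  shows "test_fun \<Omega> f"
proof -
  have *: "closure {x. f x \<noteq> 0} \<subseteq> K"
    using assms compact_imp_closed closure_minimal by blast
  then have "closure {x. f x \<noteq> 0} = K \<inter> closure {x. f x \<noteq> 0}" by blast
  then have "compact (closure {x. f x \<noteq> 0})"
    using assms(3) compact_Int_closed[OF assms(3) closed_closure] by metis
  then show ?thesis using assms * unfolding test_fun_def by blast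
qed

lemma test_fun_diff:
  assumes \<Omega>: "open \<Omega>" and \<phi>: "test_fun \<Omega> \<phi>" and \<psi>: "test_fun \<Omega> \<psi>"
  shows "test_fun \<Omega> (\<lambda>x. \<phi> x - \<psi> x)" and "grad (\<lambda>x. \<phi> x - \<psi> x) x = grad \<phi> x - grad \<psi> x"
proof -
  show "grad (\<lambda>x. \<phi> x - \<psi> x) x = grad \<phi> x - grad \<psi> x"
    by (rule GDERIV_grad[OF GDERIV_diff[OF test_fun_GDERIV[OF \<Omega> \<phi>] test_fun_GDERIV[OF \<Omega> \<psi>]]])
  let ?K = "closure {x. \<phi> x \<noteq> 0} \<union> closure {x. \<psi> x \<noteq> 0}"
  show "test_fun \<Omega> (\<lambda>x. \<phi> x - \<psi> x)"
  proof (rule test_funI)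
    show "smooth_on \<Omega> (\<lambda>x. \<phi> x - \<psi> x)"
      using \<phi> \<psi> unfolding test_fun_def
      by (auto intro!: smooth_alg_smooth[OF \<Omega>] smooth_alg_diff intro: smooth_alg.base)
    show "{x. \<phi> x - \<psi> x \<noteq> 0} \<subseteq> ?K"
    proof
      fix x assume "x \<in> {x. \<phi> x - \<psi> x \<noteq> 0}"
      then have "x \<in> {x. \<phi> x \<noteq> 0} \<or> x \<in> {x. \<psi> x \<noteq> 0}" by auto
      then show "x \<in> ?K"
        using closure_subset[of "{x. \<phi> x \<noteq> 0}"] closure_subset[of "{x. \<psi> x \<noteq> 0}"] by blast
    qed
  qed (use \<phi> \<psi> in \<open>auto simp: test_fun_def\<close>)
qed

text \<open>\<phi> supplies the compact support, so \<open>g\<close> contributes only its regularity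
  on \<Omega>. All nonlinear test functions below are written in this form.\<close>

lemma test_fun_mult:
  assumes \<Omega>: "open \<Omega>" and \<phi>: "test_fun \<Omega> \<phi>" and g: "g \<in> smooth_alg \<Omega>"
  shows "test_fun \<Omega> (\<lambda>x. \<phi> x * g x)"
proof -
  have "smooth_on \<Omega> (\<lambda>x. \<phi> x * g x)"
    using \<phi> g unfolding test_fun_def by (intro smooth_alg_smooth[OF \<Omega>] smooth_alg.mult) (auto intro: smooth_alg.base)
  moreover have "{x. \<phi> x * g x \<noteq> 0} \<subseteq> closure {x. \<phi> x \<noteq> 0}"
    using closure_subset[of "{x. \<phi> x \<noteq> 0}"] by auto
  ultimately show ?thesis
    using \<phi> unfolding test_fun_def[of \<Omega> \<phi>] by (intro test_funI) auto
qed

section \<open>The weighted Sobolev inequality\<close>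

lemma powr_add_le:
  fixes a b r :: real
  assumes "0 \<le> a" "0 \<le> b" "0 \<le> r"
  shows "(a + b) powr r \<le> 2 powr r * (a powr r + b powr r)"
proof -
  have "(a + b) powr r \<le> (2 * max a b) powr r"
    using assms by (intro powr_mono2) auto
  also have "\<dots> = 2 powr r * max a b powr r"
    using assms by (simp add: powr_mult)
  also have "max a b powr r \<le> a powr r + b powr r"
    using assms by (auto simp: max_def)
  finally show ?thesis by simp
qed

lemma norm_add_powr_le:
  assumes "0 \<le> r"
  shows "norm (x + y) powr r \<le> 2 powr r * (norm x powr r + norm y powr r)"
  using powr_add_le[of "norm x" "norm y" r] powr_mono2[of r "norm (x + y)" "norm x + norm y"] assms
  by (smt (verit) norm_ge_zero norm_triangle_ineq)

lemma norm_diff_powr_le: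
  assumes "0 \<le> r"
  shows "norm (x - y) powr r \<le> 2 powr r * (norm x powr r + norm y powr r)"
  using norm_add_powr_le[OF assms, of x "- y"] by simp

lemma norm_powr_le_diff:
  assumes "0 \<le> r"
  shows "norm x powr r \<le> 2 powr r * (norm (x - y) powr r + norm y powr r)"
    and "norm x powr r \<le> 2 powr r * (norm y powr r + norm (y - x) powr r)"
  using norm_add_powr_le[OF assms, of "x - y" y] norm_diff_powr_le[OF assms, of y "y - x"] by simp_all

lemma nn_integral_real_tendsto_0:
  fixes f :: "nat \<Rightarrow> 'a \<Rightarrow> real"
  assumes "\<And>n. integrable M (f n)" "\<And>n x. 0 \<le> f n x"
  shows "(\<lambda>n. \<integral>\<^sup>+x. ennreal (f n x) \<partial>M) \<longlonglongrightarrow> 0 \<longleftrightarrow> (\<lambda>n. \<integral>x. f n x \<partial>M) \<longlonglongrightarrow> 0"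
proof -
  have "(\<integral>\<^sup>+x. ennreal (f n x) \<partial>M) = ennreal (\<integral>x. f n x \<partial>M)" for n
    using assms by (intro nn_integral_eq_integral) auto
  then show ?thesis
    using assms tendsto_ennreal_iff[of "\<lambda>n. \<integral>x. f n x \<partial>M" sequentially 0] by simp
qed

lemma Fatou_real:
  fixes f :: "nat \<Rightarrow> 'a \<Rightarrow> real"
  assumes "\<And>n. integrable M (f n)" "\<And>n x. 0 \<le> f n x" "g \<in> borel_measurable M" "\<And>x. 0 \<le> g x"
    and "AE x in M. (\<lambda>n. f n x) \<longlonglongrightarrow> g x"
    and "\<And>n. (\<integral>x. f n x \<partial>M) \<le> c n" "c \<longlonglongrightarrow> C"
  shows "integrable M g" "(\<integral>x. g x \<partial>M) \<le> C"
proof -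
  have "(\<integral>\<^sup>+x. ennreal (g x) \<partial>M) = (\<integral>\<^sup>+x. liminf (\<lambda>n. ennreal (f n x)) \<partial>M)"
    using assms(5)
    by (intro nn_integral_cong_AE) (auto elim!: eventually_mono intro!: lim_imp_Liminf[symmetric] tendsto_ennrealI)
  also have "\<dots> \<le> liminf (\<lambda>n. \<integral>\<^sup>+x. ennreal (f n x) \<partial>M)"
    using assms(1) by (intro nn_integral_liminf) auto
  also have "\<dots> = liminf (\<lambda>n. ennreal (\<integral>x. f n x \<partial>M))"
    using assms(1,2) by (simp add: nn_integral_eq_integral)
  also have "\<dots> \<le> liminf (\<lambda>n. ennreal (c n))"
    using assms(6) by (intro Liminf_mono always_eventually allI ennreal_leI) auto
  also have "\<dots> = ennreal C"
    using assms(7) by (intro lim_imp_Liminf tendsto_ennrealI) auto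
  finally have *: "(\<integral>\<^sup>+x. ennreal (g x) \<partial>M) \<le> ennreal C" .
  have "0 \<le> c n" for n
    by (rule order_trans[OF Bochner_Integration.integral_nonneg assms(6)]) (rule assms(2))
  then have "0 \<le> C" using assms(7) LIMSEQ_le_const by blast
  show "integrable M g"
    using * assms(3,4) by (intro integrableI_nonneg) (auto intro!: le_less_trans[OF _ ennreal_less_top])
  then show "(\<integral>x. g x \<partial>M) \<le> C"
    using * assms(4) \<open>0 \<le> C\<close> by (simp add: nn_integral_eq_integral)
qed

text \<open>Dominated convergence for a majorant consisting of a fixed integrable function and a
  remainder vanishing in L^1: \<open>min (f n x) (h x)\<close> has the fixed majorant
  \<open>h\<close>, and the excess is at most \<open>r n x\<close>. This fits approximants that are
  close to \<open>u\<close> in L^q without a common pointwise bound.\<close>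

lemma integral_dominated_plus_small:
  fixes f r :: "nat \<Rightarrow> 'a \<Rightarrow> real"
  assumes f[measurable]: "\<And>n. f n \<in> borel_measurable M" and f0: "\<And>n x. 0 \<le> f n x"
    and lim: "AE x in M. (\<lambda>n. f n x) \<longlonglongrightarrow> 0"
    and bound: "\<And>n. AE x in M. f n x \<le> h x + r n x"
    and h: "integrable M h" and h0: "\<And>x. 0 \<le> h x"
    and r: "\<And>n. integrable M (r n)" and r0: "\<And>n x. 0 \<le> r n x"
    and rlim: "(\<lambda>n. \<integral>x. r n x \<partial>M) \<longlonglongrightarrow> 0"
  shows "\<And>n. integrable M (f n)" "(\<lambda>n. \<integral>x. f n x \<partial>M) \<longlonglongrightarrow> 0"
proof -
  have [measurable]: "h \<in> borel_measurable M" using h by auto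
  show i: "integrable M (f n)" for n
    by (rule Bochner_Integration.integrable_bound[OF Bochner_Integration.integrable_add[OF h r[of n]]])
      (use bound[of n] f0 h0 r0 in \<open>auto elim!: eventually_mono\<close>)
  have m: "integrable M (\<lambda>x. min (f n x) (h x))" for n
    by (rule Bochner_Integration.integrable_bound[OF h]) (use f0 h0 in auto)
  have "(\<lambda>n. \<integral>x. min (f n x) (h x) \<partial>M) \<longlonglongrightarrow> (\<integral>x. 0 \<partial>M)"
  proof (rule integral_dominated_convergence[where w = h])
    show "AE x in M. (\<lambda>n. min (f n x) (h x)) \<longlonglongrightarrow> 0"
      using lim
    proof eventually_elim
      case (elim x)
      then show ?case
        by (rule tendsto_sandwich[rotated 2, OF tendsto_const]) (use f0 h0 in auto)
    qed
    show "AE x in M. norm (min (f n x) (h x)) \<le> h x" for n using f0[of n] h0 by auto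
  qed (use h in auto)
  then have *: "(\<lambda>n. (\<integral>x. min (f n x) (h x) \<partial>M) + (\<integral>x. r n x \<partial>M)) \<longlonglongrightarrow> 0"
    using tendsto_add[OF _ rlim] by simp
  show "(\<lambda>n. \<integral>x. f n x \<partial>M) \<longlonglongrightarrow> 0"
  proof (rule tendsto_sandwich[OF _ _ tendsto_const *])
    show "\<forall>\<^sub>F n in sequentially. 0 \<le> (\<integral>x. f n x \<partial>M)"
      using f0 by (simp add: Bochner_Integration.integral_nonneg)
    have "(\<integral>x. f n x \<partial>M) \<le> (\<integral>x. min (f n x) (h x) + r n x \<partial>M)" for n
    proof (rule integral_mono_AE[OF i Bochner_Integration.integrable_add[OF m r]])
      show "AE x in M. f n x \<le> min (f n x) (h x) + r n x"
        using bound[of n] by eventually_elim (use r0[of n] in \<open>auto simp: min_def\<close>)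
    qed
    then show "\<forall>\<^sub>F n in sequentially. (\<integral>x. f n x \<partial>M) \<le> (\<integral>x. min (f n x) (h x) \<partial>M) + (\<integral>x. r n x \<partial>M)"
      using m r by simp
  qed
qed

text \<open>Hoelder's inequality with the exponents moved inside, so that no conjugate exponents
  occur. After normalising both integrals to 1 it is the integrated weighted inequality between
  arithmetic and geometric mean.\<close>

lemma Hoelder_interpolation:
  fixes f g :: "'a \<Rightarrow> real" and a b :: real
  assumes f: "integrable M f" and g: "integrable M g" and f0: "\<And>x. 0 \<le> f x" and g0: "\<And>x. 0 \<le> g x"
    and ab: "0 < a" "0 < b" "a + b = 1"
  shows "integrable M (\<lambda>x. f x powr a * g x powr b)"
    and "(\<integral>x. f x powr a * g x powr b \<partial>M) \<le> (\<integral>x. f x \<partial>M) powr a * (\<integral>x. g x \<partial>M) powr b"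
proof -
  have [measurable]: "f \<in> borel_measurable M" "g \<in> borel_measurable M" using f g by auto
  have young: "s powr a * t powr b \<le> a * s + b * t" if "0 \<le> s" "0 \<le> t" for s t :: real
    using Youngs_inequality_0[of a b s t] that ab by (cases "s = 0 \<or> t = 0") auto
  show i: "integrable M (\<lambda>x. f x powr a * g x powr b)"
    by (rule Bochner_Integration.integrable_bound[of _ "\<lambda>x. a * f x + b * g x"])
      (use f g f0 g0 young ab in auto)
  let ?A = "\<integral>x. f x \<partial>M" and ?B = "\<integral>x. g x \<partial>M"
  show "(\<integral>x. f x powr a * g x powr b \<partial>M) \<le> ?A powr a * ?B powr b"
  proof (cases "?A = 0 \<or> ?B = 0")
    case True
    then have "(AE x in M. f x = 0) \<or> (AE x in M. g x = 0)"
      using integral_nonneg_eq_0_iff_AE[OF f] integral_nonneg_eq_0_iff_AE[OF g] f0 g0 by auto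
    then have "AE x in M. f x powr a * g x powr b = 0"
      by (elim disjE; elim eventually_mono) auto
    then have "(\<integral>x. f x powr a * g x powr b \<partial>M) = 0"
      by (rule integral_eq_zero_AE)
    then show ?thesis by simp
  next
    case False
    then have AB: "?A > 0" "?B > 0"
      using Bochner_Integration.integral_nonneg[of M f] Bochner_Integration.integral_nonneg[of M g] f0 g0 by (auto simp: less_le)
    have "f x powr a * g x powr b \<le> ?A powr a * ?B powr b * (a / ?A * f x + b / ?B * g x)" for x
    proof -
      have "(f x / ?A) powr a * (g x / ?B) powr b \<le> a * (f x / ?A) + b * (g x / ?B)"
        using f0 g0 AB by (intro young) auto
      then show ?thesis
        using AB f0 g0 by (simp add: powr_divide field_simps)
    qed
    then have "(\<integral>x. f x powr a * g x powr b \<partial>M)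
        \<le> (\<integral>x. ?A powr a * ?B powr b * (a / ?A * f x + b / ?B * g x) \<partial>M)"
      using f g by (intro integral_mono[OF i]) auto
    also have "\<dots> = ?A powr a * ?B powr b * (a / ?A * ?A + b / ?B * ?B)"
      using f g by simp
    also have "\<dots> = ?A powr a * ?B powr b" using AB ab by simp
    finally show ?thesis .
  qed
qed

section \<open>The weighted measure on \<Omega>\<close>

locale weighted_sobolev =
  fixes \<Omega> :: "'a::euclidean_space set" and w :: "'a \<Rightarrow> real" and p q S :: real
  assumes open_\<Omega>: "open \<Omega>" and weight: "is_weight \<Omega> w"
    and p1: "1 < p" and pq: "p < q" and S0: "0 < S"
    and sobolev: "\<And>u. test_fun \<Omega> u \<Longrightarrow>
      S * (LINT x:\<Omega>|lebesgue. \<bar>u x\<bar> powr q * w x) powr (1 / q)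
        \<le> (LINT x:\<Omega>|lebesgue. norm (grad u x) powr p * w x) powr (1 / p)"
begin

text \<open>\<open>ennreal\<close> cuts off negative values of \<open>w\<close>, which within
  \<Omega> occur on a null set only.\<close>

definition M :: "'a measure" where
  "M = density lebesgue (\<lambda>x. ennreal (w x * indicator \<Omega> x))"

lemma measurable_w[measurable]: "w \<in> borel_measurable lebesgue"
  using weight unfolding is_weight_def by auto

lemma sets_\<Omega>[measurable]: "\<Omega> \<in> sets lebesgue"
  using open_\<Omega> by (simp add: borel_open sets_completionI_sets)

lemma sets_M[measurable_cong, simp]: "sets M = sets lebesgue"
  unfolding M_def by simp

lemma weight_nonneg: "AE x in lebesgue. 0 \<le> w x * indicator \<Omega> x"
proof -
  have "AE x in lebesgue. x \<in> \<Omega> \<longrightarrow> 0 < w x"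
    using weight unfolding is_weight_def by auto
  then show ?thesis by eventually_elim (auto simp: indicator_def)
qed

text \<open>Positivity of \<open>w\<close> almost everywhere in \<Omega> is what lets a statement
  about \<open>M\<close> return to Lebesgue measure at the very end.\<close>

lemma AE_M: "(AE x in M. P x) \<longleftrightarrow> (AE x in lebesgue. x \<in> \<Omega> \<longrightarrow> P x)"
proof -
  have w: "AE x in lebesgue. x \<in> \<Omega> \<longrightarrow> 0 < w x"
    using weight unfolding is_weight_def by auto
  have "(AE x in M. P x) \<longleftrightarrow> (AE x in lebesgue. 0 < ennreal (w x * indicator \<Omega> x) \<longrightarrow> P x)"
    unfolding M_def by (intro AE_density) auto
  also have "\<dots> \<longleftrightarrow> (AE x in lebesgue. x \<in> \<Omega> \<longrightarrow> P x)"
  proof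
    assume "AE x in lebesgue. 0 < ennreal (w x * indicator \<Omega> x) \<longrightarrow> P x"
    with w show "AE x in lebesgue. x \<in> \<Omega> \<longrightarrow> P x" by eventually_elim auto
  next
    assume "AE x in lebesgue. x \<in> \<Omega> \<longrightarrow> P x"
    then show "AE x in lebesgue. 0 < ennreal (w x * indicator \<Omega> x) \<longrightarrow> P x"
      by eventually_elim (auto simp: indicator_def)
  qed
  finally show ?thesis .
qed

lemma LINT_M:
  assumes [measurable]: "f \<in> borel_measurable lebesgue"
  shows "(LINT x:\<Omega>|lebesgue. f x * w x) = (\<integral>x. f x \<partial>M)"
proof -
  have "(\<integral>x. f x \<partial>M) = (\<integral>x. (w x * indicator \<Omega> x) *\<^sub>R f x \<partial>lebesgue)"
    unfolding M_def using weight_nonneg by (intro integral_density) auto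
  also have "\<dots> = (LINT x:\<Omega>|lebesgue. f x * w x)"
    unfolding set_lebesgue_integral_def by (intro Bochner_Integration.integral_cong) auto
  finally show ?thesis by simp
qed

lemma nn_integral_M:
  assumes [measurable]: "f \<in> borel_measurable lebesgue" and "\<And>x. 0 \<le> f x"
  shows "(\<integral>\<^sup>+x. ennreal (f x * w x) * indicator \<Omega> x \<partial>lebesgue) = (\<integral>\<^sup>+x. ennreal (f x) \<partial>M)"
proof -
  have "(\<integral>\<^sup>+x. ennreal (f x) \<partial>M) = (\<integral>\<^sup>+x. ennreal (w x * indicator \<Omega> x) * ennreal (f x) \<partial>lebesgue)"
    unfolding M_def by (intro nn_integral_density) auto
  also have "\<dots> = (\<integral>\<^sup>+x. ennreal (f x * w x) * indicator \<Omega> x \<partial>lebesgue)"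
    using assms(2) by (intro nn_integral_cong) (auto simp: indicator_def ennreal_mult' mult.commute)
  finally show ?thesis by simp
qed

lemma continuous_measurable_M:
  fixes f :: "'a \<Rightarrow> 'b::topological_space"
  assumes "continuous_on UNIV f" shows "f \<in> borel_measurable lebesgue"
  using borel_measurable_continuous_onI[OF assms] by (simp add: measurable_completion)

lemma integrable_M_compact_support:
  fixes h :: "'a \<Rightarrow> real"
  assumes h: "continuous_on UNIV h" and K: "compact K" "K \<subseteq> \<Omega>" and 0: "\<And>x. x \<notin> K \<Longrightarrow> h x = 0"
  shows "integrable M h"
proof -
  have [measurable]: "h \<in> borel_measurable lebesgue" using continuous_measurable_M[OF h] .
  have [measurable]: "K \<in> sets lebesgue"
    using K(1) by (simp add: borel_compact sets_completionI_sets)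
  have "compact (h ` K)"
    using K(1) h continuous_on_subset compact_continuous_image by blast
  then obtain B where B: "\<And>x. x \<in> K \<Longrightarrow> norm (h x) \<le> B"
    by (meson bounded_iff compact_imp_bounded image_eqI)
  have "set_integrable lebesgue K w"
    using weight K unfolding is_weight_def by blast
  then have "integrable lebesgue (\<lambda>x. B * (indicator K x *\<^sub>R w x))"
    unfolding set_integrable_def by simp
  then have "integrable lebesgue (\<lambda>x. (w x * indicator \<Omega> x) *\<^sub>R h x)"
  proof (rule Bochner_Integration.integrable_bound)
    show "AE x in lebesgue. norm ((w x * indicator \<Omega> x) *\<^sub>R h x) \<le> norm (B * (indicator K x *\<^sub>R w x))"
      using weight_nonneg
    proof eventually_elim
      case (elim x)
      show ?case
      proof (cases "x \<in> K")
        case True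
        then show ?thesis
          using mult_right_mono[of "\<bar>h x\<bar>" "\<bar>B\<bar>" "\<bar>w x\<bar>"] B[OF True] K(2)
          by (auto simp: abs_mult mult.commute)
      qed (use 0 in auto)
    qed
  qed auto
  then show ?thesis
    unfolding M_def using weight_nonneg by (subst integrable_density) auto
qed

lemma test_fun_measurable:
  assumes "test_fun \<Omega> \<phi>"
  shows "\<phi> \<in> borel_measurable lebesgue" "grad \<phi> \<in> borel_measurable lebesgue"
  using test_fun_continuous[OF open_\<Omega> assms] continuous_measurable_M by blast+

lemma test_fun_integrable:
  assumes "test_fun \<Omega> \<phi>" "0 < r"
  shows "integrable M (\<lambda>x. \<bar>\<phi> x\<bar> powr r)" "integrable M (\<lambda>x. norm (grad \<phi> x) powr r)"
proof -
  note c = test_fun_continuous[OF open_\<Omega> assms(1)]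
  let ?K = "closure {x. \<phi> x \<noteq> 0}"
  have K: "compact ?K" "?K \<subseteq> \<Omega>" using assms(1) unfolding test_fun_def by auto
  show "integrable M (\<lambda>x. \<bar>\<phi> x\<bar> powr r)"
  proof (rule integrable_M_compact_support[OF _ K])
    show "\<bar>\<phi> x\<bar> powr r = 0" if "x \<notin> ?K" for x
      using that closure_subset[of "{x. \<phi> x \<noteq> 0}"] by auto
  qed (use c assms(2) in \<open>auto intro!: continuous_intros continuous_on_powr'\<close>)
  show "integrable M (\<lambda>x. norm (grad \<phi> x) powr r)"
  proof (rule integrable_M_compact_support[OF _ K])
    show "norm (grad \<phi> x) powr r = 0" if "x \<notin> ?K" for x
      using test_fun_grad_0[OF that] by simp
  qed (use c assms(2) in \<open>auto intro!: continuous_intros continuous_on_powr'\<close>)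
qed

lemma sobolev_test:
  assumes "test_fun \<Omega> \<phi>"
  shows "(\<integral>x. \<bar>\<phi> x\<bar> powr q \<partial>M) \<le> S powr (- q) * (\<integral>x. norm (grad \<phi> x) powr p \<partial>M) powr (q / p)"
proof -
  note [measurable] = test_fun_measurable[OF assms]
  let ?A = "\<integral>x. \<bar>\<phi> x\<bar> powr q \<partial>M" and ?B = "\<integral>x. norm (grad \<phi> x) powr p \<partial>M"
  have A0: "0 \<le> ?A" and B0: "0 \<le> ?B" by (auto intro: Bochner_Integration.integral_nonneg)
  have "S * ?A powr (1 / q) \<le> ?B powr (1 / p)"
    using sobolev[OF assms] by (simp add: LINT_M)
  then have "(S * ?A powr (1 / q)) powr q \<le> (?B powr (1 / p)) powr q"
    using S0 p1 pq by (intro powr_mono2) auto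
  then have "S powr q * ?A \<le> ?B powr (q / p)"
    using S0 p1 pq A0 B0 by (simp add: powr_mult powr_powr)
  then show ?thesis
    using S0 by (simp add: powr_minus field_simps)
qed

section \<open>The energy space: approximation, Sobolev inequality, chain rule\<close>

lemma D1pwE:
  assumes "D1pw \<Omega> w p u G"
  obtains \<phi> where "\<And>k. test_fun \<Omega> (\<phi> k)"
    and "\<And>k. integrable M (\<lambda>x. norm (grad (\<phi> k) x - G x) powr p)"
    and "(\<lambda>k. \<integral>x. norm (grad (\<phi> k) x - G x) powr p \<partial>M) \<longlonglongrightarrow> 0"
    and "AE x in M. (\<lambda>k. \<phi> k x) \<longlonglongrightarrow> u x"
    and "integrable M (\<lambda>x. norm (G x) powr p)"
proof -
  have G[measurable]: "G \<in> borel_measurable lebesgue" and u[measurable]: "u \<in> borel_measurable lebesgue"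
    using assms unfolding D1pw_def by auto
  obtain \<phi> where t: "\<And>k. test_fun \<Omega> (\<phi> k)"
    and l: "(\<lambda>k. \<integral>\<^sup>+ x. ennreal (norm (grad (\<phi> k) x - G x) powr p * w x) * indicator \<Omega> x \<partial>lebesgue) \<longlonglongrightarrow> 0"
    and ae: "AE x in lebesgue. x \<in> \<Omega> \<longrightarrow> (\<lambda>k. \<phi> k x) \<longlonglongrightarrow> u x"
    using assms unfolding D1pw_def by blast
  note [measurable] = test_fun_measurable[OF t]
  have l': "(\<lambda>k. \<integral>\<^sup>+ x. ennreal (norm (grad (\<phi> k) x - G x) powr p) \<partial>M) \<longlonglongrightarrow> 0"
    using l by (simp add: nn_integral_M)
  \<comment> \<open>Convergence to 0 makes at least one of the extended integrals finite. With the
    gradient of that test function in L^p, this puts \<open>G\<close> in L^p, and then every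
    difference is integrable.\<close>
  then have "\<forall>\<^sub>F k in sequentially. (\<integral>\<^sup>+ x. ennreal (norm (grad (\<phi> k) x - G x) powr p) \<partial>M) < \<infinity>"
    by (rule order_tendstoD) simp
  then obtain k where "(\<integral>\<^sup>+ x. ennreal (norm (grad (\<phi> k) x - G x) powr p) \<partial>M) < \<infinity>"
    by (auto simp: eventually_sequentially)
  then have k: "integrable M (\<lambda>x. norm (grad (\<phi> k) x - G x) powr p)"
    by (intro integrableI_nonneg) auto
  have Gi: "integrable M (\<lambda>x. norm (G x) powr p)"
  proof (rule Bochner_Integration.integrable_bound)
    show "integrable M (\<lambda>x. 2 powr p * (norm (grad (\<phi> k) x) powr p + norm (grad (\<phi> k) x - G x) powr p))"
      using k test_fun_integrable(2)[OF t, of p] p1 by auto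
    show "AE x in M. norm (norm (G x) powr p)
        \<le> norm (2 powr p * (norm (grad (\<phi> k) x) powr p + norm (grad (\<phi> k) x - G x) powr p))"
      using norm_powr_le_diff(2)[of p "G _" "grad (\<phi> k) _"] p1 by (intro always_eventually allI) (simp add: powr_ge_zero)
  qed auto
  have i: "integrable M (\<lambda>x. norm (grad (\<phi> k) x - G x) powr p)" for k
  proof (rule Bochner_Integration.integrable_bound)
    show "integrable M (\<lambda>x. 2 powr p * (norm (grad (\<phi> k) x) powr p + norm (G x) powr p))"
      using Gi test_fun_integrable(2)[OF t, of p] p1 by auto
    show "AE x in M. norm (norm (grad (\<phi> k) x - G x) powr p)
        \<le> norm (2 powr p * (norm (grad (\<phi> k) x) powr p + norm (G x) powr p))"
      using norm_diff_powr_le[of p "grad (\<phi> k) _" "G _"] p1 by (intro always_eventually) auto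
  qed auto
  show thesis
  proof (rule that[OF t i _ _ Gi])
    show "(\<lambda>k. \<integral>x. norm (grad (\<phi> k) x - G x) powr p \<partial>M) \<longlonglongrightarrow> 0"
      using l' nn_integral_real_tendsto_0[OF i] by simp
  qed (use ae in \<open>auto simp: AE_M\<close>)
qed

lemma D1pwI:
  assumes [measurable]: "u \<in> borel_measurable lebesgue" "G \<in> borel_measurable lebesgue"
    and t: "\<And>k. test_fun \<Omega> (\<phi> k)"
    and i: "\<And>k. integrable M (\<lambda>x. norm (grad (\<phi> k) x - G x) powr p)"
    and l: "(\<lambda>k. \<integral>x. norm (grad (\<phi> k) x - G x) powr p \<partial>M) \<longlonglongrightarrow> 0"
    and ae: "AE x in M. (\<lambda>k. \<phi> k x) \<longlonglongrightarrow> u x"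
  shows "D1pw \<Omega> w p u G"
proof -
  note [measurable] = test_fun_measurable[OF t]
  have "(\<lambda>k. \<integral>\<^sup>+ x. ennreal (norm (grad (\<phi> k) x - G x) powr p) \<partial>M) \<longlonglongrightarrow> 0"
    using l nn_integral_real_tendsto_0[OF i] by simp
  then show ?thesis
    using t ae unfolding D1pw_def by (intro conjI exI[of _ \<phi>]) (auto simp: AE_M nn_integral_M)
qed

text \<open>The factor \<open>2 powr q\<close> is an artefact of using \<open>(a + b)\<^sup>p \<le> 2\<^sup>p (a\<^sup>p + b\<^sup>p)\<close> in place of Minkowski's inequality.\<close>
definition C0 :: real where "C0 = S powr (- q) * 2 powr q"

lemma C0_pos: "0 < C0" using S0 by (simp add: C0_def)

text \<open>The gradient side passes to the limit by L^p convergence, the other side by Fatou's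
  lemma along the almost everywhere convergent approximants.\<close>

lemma D1pw_sobolev:
  assumes D: "D1pw \<Omega> w p u G"
  shows "integrable M (\<lambda>x. \<bar>u x\<bar> powr q)"
    and "(\<integral>x. \<bar>u x\<bar> powr q \<partial>M) \<le> C0 * (\<integral>x. norm (G x) powr p \<partial>M) powr (q / p)"
proof -
  have [measurable]: "G \<in> borel_measurable lebesgue" "u \<in> borel_measurable lebesgue"
    using D unfolding D1pw_def by auto
  obtain \<phi> where t: "\<And>k. test_fun \<Omega> (\<phi> k)"
    and i: "\<And>k. integrable M (\<lambda>x. norm (grad (\<phi> k) x - G x) powr p)"
    and l: "(\<lambda>k. \<integral>x. norm (grad (\<phi> k) x - G x) powr p \<partial>M) \<longlonglongrightarrow> 0"
    and ae: "AE x in M. (\<lambda>k. \<phi> k x) \<longlonglongrightarrow> u x"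
    and Gi: "integrable M (\<lambda>x. norm (G x) powr p)"
    using D1pwE[OF D] by blast
  note [measurable] = test_fun_measurable[OF t]
  let ?e = "\<lambda>k. \<integral>x. norm (grad (\<phi> k) x - G x) powr p \<partial>M" and ?I = "\<integral>x. norm (G x) powr p \<partial>M"
  have b: "(\<integral>x. \<bar>\<phi> k x\<bar> powr q \<partial>M) \<le> C0 * (?e k + ?I) powr (q / p)" for k
  proof -
    have "(\<integral>x. norm (grad (\<phi> k) x) powr p \<partial>M)
        \<le> (\<integral>x. 2 powr p * (norm (grad (\<phi> k) x - G x) powr p + norm (G x) powr p) \<partial>M)"
      using test_fun_integrable(2)[OF t, of p] i Gi p1
      by (intro integral_mono norm_powr_le_diff(1)) auto
    also have "\<dots> = 2 powr p * (?e k + ?I)" using i Gi by simp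
    finally have "(\<integral>x. norm (grad (\<phi> k) x) powr p \<partial>M) powr (q / p) \<le> (2 powr p * (?e k + ?I)) powr (q / p)"
      using p1 pq by (intro powr_mono2) (auto intro: Bochner_Integration.integral_nonneg)
    also have "\<dots> = 2 powr q * (?e k + ?I) powr (q / p)"
      using p1 by (subst powr_mult) (auto simp: powr_powr intro!: Bochner_Integration.integral_nonneg add_nonneg_nonneg)
    finally show ?thesis
      using order_trans[OF sobolev_test[OF t] mult_left_mono] by (simp add: C0_def mult.assoc)
  qed
  have "(\<lambda>k. C0 * (?e k + ?I) powr (q / p)) \<longlonglongrightarrow> C0 * (0 + ?I) powr (q / p)"
    using p1 pq by (intro tendsto_mult tendsto_const tendsto_powr' tendsto_add l)
      (auto intro!: always_eventually Bochner_Integration.integral_nonneg add_nonneg_nonneg)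
  then have lim: "(\<lambda>k. C0 * (?e k + ?I) powr (q / p)) \<longlonglongrightarrow> C0 * ?I powr (q / p)" by simp
  have ae': "AE x in M. (\<lambda>k. \<bar>\<phi> k x\<bar> powr q) \<longlonglongrightarrow> \<bar>u x\<bar> powr q"
    using ae by eventually_elim (use p1 pq in \<open>auto intro!: tendsto_intros tendsto_powr'\<close>)
  have qi: "integrable M (\<lambda>x. \<bar>\<phi> k x\<bar> powr q)" for k
    using test_fun_integrable(1)[OF t, of q] p1 pq by auto
  show "integrable M (\<lambda>x. \<bar>u x\<bar> powr q)"
    and "(\<integral>x. \<bar>u x\<bar> powr q \<partial>M) \<le> C0 * (\<integral>x. norm (G x) powr p \<partial>M) powr (q / p)"
    using Fatou_real[OF qi _ _ _ ae' b lim] by auto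
qed

text \<open>For fixed \<open>k\<close> the difference of \<open>\<phi> k\<close> and
  \<open>u\<close> is itself in the space, approximated by \<open>\<phi> k - \<phi> j\<close> as j
  grows. Sobolev's inequality for it turns convergence of gradients into L^q convergence.\<close>

lemma D1pw_approx:
  assumes D: "D1pw \<Omega> w p u G"
  obtains \<phi> where "\<And>k. test_fun \<Omega> (\<phi> k)"
    and "\<And>k. integrable M (\<lambda>x. norm (grad (\<phi> k) x - G x) powr p)"
    and "(\<lambda>k. \<integral>x. norm (grad (\<phi> k) x - G x) powr p \<partial>M) \<longlonglongrightarrow> 0"
    and "AE x in M. (\<lambda>k. \<phi> k x) \<longlonglongrightarrow> u x"
    and "integrable M (\<lambda>x. norm (G x) powr p)"
    and "\<And>k. integrable M (\<lambda>x. \<bar>\<phi> k x - u x\<bar> powr q)"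
    and "(\<lambda>k. \<integral>x. \<bar>\<phi> k x - u x\<bar> powr q \<partial>M) \<longlonglongrightarrow> 0"
proof -
  have [measurable]: "G \<in> borel_measurable lebesgue" "u \<in> borel_measurable lebesgue"
    using D unfolding D1pw_def by auto
  obtain \<phi> where t: "\<And>k. test_fun \<Omega> (\<phi> k)"
    and i: "\<And>k. integrable M (\<lambda>x. norm (grad (\<phi> k) x - G x) powr p)"
    and l: "(\<lambda>k. \<integral>x. norm (grad (\<phi> k) x - G x) powr p \<partial>M) \<longlonglongrightarrow> 0"
    and ae: "AE x in M. (\<lambda>k. \<phi> k x) \<longlonglongrightarrow> u x"
    and Gi: "integrable M (\<lambda>x. norm (G x) powr p)"
    using D1pwE[OF D] by blast
  note [measurable] = test_fun_measurable[OF t]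
  have D': "D1pw \<Omega> w p (\<lambda>x. \<phi> k x - u x) (\<lambda>x. grad (\<phi> k) x - G x)" for k
  proof (rule D1pwI[where \<phi> = "\<lambda>j x. \<phi> k x - \<phi> j x"])
    show "test_fun \<Omega> (\<lambda>x. \<phi> k x - \<phi> j x)" for j using test_fun_diff(1)[OF open_\<Omega> t t] .
    have *: "norm (grad (\<lambda>x. \<phi> k x - \<phi> j x) x - (grad (\<phi> k) x - G x)) = norm (grad (\<phi> j) x - G x)" for j x
      unfolding test_fun_diff(2)[OF open_\<Omega> t t] by (simp add: norm_minus_commute)
    show "integrable M (\<lambda>x. norm (grad (\<lambda>x. \<phi> k x - \<phi> j x) x - (grad (\<phi> k) x - G x)) powr p)" for j
      unfolding * by (rule i)
    show "(\<lambda>j. \<integral>x. norm (grad (\<lambda>x. \<phi> k x - \<phi> j x) x - (grad (\<phi> k) x - G x)) powr p \<partial>M) \<longlonglongrightarrow> 0"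
      unfolding * by (rule l)
    show "AE x in M. (\<lambda>j. \<phi> k x - \<phi> j x) \<longlonglongrightarrow> \<phi> k x - u x"
      using ae by eventually_elim (auto intro: tendsto_intros)
  qed auto
  have "(\<lambda>k. C0 * (\<integral>x. norm (grad (\<phi> k) x - G x) powr p \<partial>M) powr (q / p)) \<longlonglongrightarrow> C0 * 0 powr (q / p)"
    using p1 pq by (intro tendsto_mult tendsto_const tendsto_powr' l)
      (auto intro!: always_eventually Bochner_Integration.integral_nonneg)
  then have c: "(\<lambda>k. C0 * (\<integral>x. norm (grad (\<phi> k) x - G x) powr p \<partial>M) powr (q / p)) \<longlonglongrightarrow> 0" by simp
  have "(\<lambda>k. \<integral>x. \<bar>\<phi> k x - u x\<bar> powr q \<partial>M) \<longlonglongrightarrow> 0"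
    by (rule tendsto_sandwich[OF _ _ tendsto_const c])
      (use D1pw_sobolev(2)[OF D'] in \<open>auto intro!: always_eventually Bochner_Integration.integral_nonneg\<close>)
  then show thesis
    using that[OF t i l ae Gi D1pw_sobolev(1)[OF D']] by blast
qed

text \<open>A chain rule for nonlinearities that depend on x as well. \<open>A\<close> multiplies
  the gradient and has to be bounded to act on L^p; \<open>Z\<close> comes from the explicit
  dependence on x, and growth \<open>\<bar>s\<bar> powr q\<close> of its p-th power is what L^q
  convergence of the approximants controls.\<close>

lemma D1pw_comp:
  fixes \<Phi> A :: "real \<Rightarrow> 'a \<Rightarrow> real" and Z :: "real \<Rightarrow> 'a \<Rightarrow> 'a"
  assumes D: "D1pw \<Omega> w p u G"
    and test: "\<And>\<phi>. test_fun \<Omega> \<phi> \<Longrightarrow> test_fun \<Omega> (\<lambda>x. \<Phi> (\<phi> x) x)"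
    and grad: "\<And>\<phi> x. test_fun \<Omega> \<phi> \<Longrightarrow>
      grad (\<lambda>x. \<Phi> (\<phi> x) x) x = A (\<phi> x) x *\<^sub>R grad \<phi> x + Z (\<phi> x) x"
    and A: "\<And>s x. \<bar>A s x\<bar> \<le> L" and Z: "\<And>s x. norm (Z s x) powr p \<le> C * \<bar>s\<bar> powr q"
    and cont: "\<And>s x. isCont (\<lambda>s. \<Phi> s x) s" "\<And>s x. isCont (\<lambda>s. A s x) s" "\<And>s x. isCont (\<lambda>s. Z s x) s"
    and m\<Phi>: "\<And>f. f \<in> borel_measurable lebesgue \<Longrightarrow> (\<lambda>x. \<Phi> (f x) x) \<in> borel_measurable lebesgue"
    and mA: "\<And>f. f \<in> borel_measurable lebesgue \<Longrightarrow> (\<lambda>x. A (f x) x) \<in> borel_measurable lebesgue"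
    and mZ: "\<And>f. f \<in> borel_measurable lebesgue \<Longrightarrow> (\<lambda>x. Z (f x) x) \<in> borel_measurable lebesgue"
  shows "D1pw \<Omega> w p (\<lambda>x. \<Phi> (u x) x) (\<lambda>x. A (u x) x *\<^sub>R G x + Z (u x) x)"
proof -
  have mG[measurable]: "G \<in> borel_measurable lebesgue" and mu[measurable]: "u \<in> borel_measurable lebesgue"
    using D unfolding D1pw_def by auto
  obtain \<phi> where t: "\<And>k. test_fun \<Omega> (\<phi> k)"
    and i: "\<And>k. integrable M (\<lambda>x. norm (grad (\<phi> k) x - G x) powr p)"
    and l: "(\<lambda>k. \<integral>x. norm (grad (\<phi> k) x - G x) powr p \<partial>M) \<longlonglongrightarrow> 0"
    and ae: "AE x in M. (\<lambda>k. \<phi> k x) \<longlonglongrightarrow> u x"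
    and Gi: "integrable M (\<lambda>x. norm (G x) powr p)"
    and iq: "\<And>k. integrable M (\<lambda>x. \<bar>\<phi> k x - u x\<bar> powr q)"
    and lq: "(\<lambda>k. \<integral>x. \<bar>\<phi> k x - u x\<bar> powr q \<partial>M) \<longlonglongrightarrow> 0"
    using D1pw_approx[OF D] by blast
  note mt[measurable] = test_fun_measurable[OF t]
  note [measurable] = m\<Phi>[OF mu] mA[OF mu] mZ[OF mu] m\<Phi>[OF mt(1)] mA[OF mt(1)] mZ[OF mt(1)]
  have uq: "integrable M (\<lambda>x. \<bar>u x\<bar> powr q)" by (rule D1pw_sobolev(1)[OF D])
  have p0: "0 \<le> p" and q0: "0 \<le> q" using p1 pq by auto
  have L: "0 \<le> L" using A[of 0 0] by linarith
  have C: "0 \<le> C" using order_trans[OF powr_ge_zero Z[of 1 0]] by simp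
  \<comment> \<open>The gradient error is \<open>A\<close> at the approximant times the difference
    of the gradients, which \<open>L\<close> controls, plus \<open>R k\<close>. The latter tends to
    0 pointwise by continuity in s, and in L^p by domination up to the small remainder
    \<open>r k\<close>.\<close>
  define R where "R = (\<lambda>k x. (A (\<phi> k x) x - A (u x) x) *\<^sub>R G x + (Z (\<phi> k x) x - Z (u x) x))"
  have [measurable]: "R k \<in> borel_measurable lebesgue" for k unfolding R_def by measurable
  define h where "h = (\<lambda>x. 2 powr p * ((2 * L) powr p * norm (G x) powr p + 2 powr p * (C * (2 powr q + 1)) * \<bar>u x\<bar> powr q))"
  define r where "r = (\<lambda>k x. 2 powr p * (2 powr p * (C * 2 powr q)) * \<bar>\<phi> k x - u x\<bar> powr q)"
  have bound: "norm (R k x) powr p \<le> h x + r k x" for k x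
  proof -
    have 1: "norm ((A (\<phi> k x) x - A (u x) x) *\<^sub>R G x) powr p \<le> (2 * L) powr p * norm (G x) powr p"
    proof -
      have "\<bar>A (\<phi> k x) x - A (u x) x\<bar> \<le> 2 * L" using A[of "\<phi> k x" x] A[of "u x" x] by linarith
      then have "norm ((A (\<phi> k x) x - A (u x) x) *\<^sub>R G x) \<le> 2 * L * norm (G x)"
        by (simp add: mult_right_mono)
      from powr_mono2[OF p0 _ this] show ?thesis using L by (simp add: powr_mult)
    qed
    have "norm (Z (\<phi> k x) x - Z (u x) x) powr p \<le> 2 powr p * (C * \<bar>\<phi> k x\<bar> powr q + C * \<bar>u x\<bar> powr q)"
      by (rule order_trans[OF norm_diff_powr_le[OF p0] mult_left_mono[OF add_mono[OF Z Z]]]) simp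
    also have "\<dots> \<le> 2 powr p * (C * (2 powr q * (\<bar>\<phi> k x - u x\<bar> powr q + \<bar>u x\<bar> powr q)) + C * \<bar>u x\<bar> powr q)"
      using norm_powr_le_diff(1)[OF q0, of "\<phi> k x" "u x"] C by (intro mult_left_mono add_mono) auto
    finally have 2: "norm (Z (\<phi> k x) x - Z (u x) x) powr p
        \<le> 2 powr p * (C * (2 powr q * (\<bar>\<phi> k x - u x\<bar> powr q + \<bar>u x\<bar> powr q)) + C * \<bar>u x\<bar> powr q)" .
    have "norm (R k x) powr p \<le> 2 powr p * ((2 * L) powr p * norm (G x) powr p
       + 2 powr p * (C * (2 powr q * (\<bar>\<phi> k x - u x\<bar> powr q + \<bar>u x\<bar> powr q)) + C * \<bar>u x\<bar> powr q))"
      unfolding R_def by (rule order_trans[OF norm_add_powr_le[OF p0] mult_left_mono[OF add_mono[OF 1 2]]]) simp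
    also have "\<dots> = h x + r k x" unfolding h_def r_def by (simp add: algebra_simps)
    finally show ?thesis .
  qed
  have Rlim: "AE x in M. (\<lambda>k. norm (R k x) powr p) \<longlonglongrightarrow> 0"
    using ae
  proof eventually_elim
    case (elim x)
    have "(\<lambda>k. A (\<phi> k x) x) \<longlonglongrightarrow> A (u x) x" "(\<lambda>k. Z (\<phi> k x) x) \<longlonglongrightarrow> Z (u x) x"
      using isCont_tendsto_compose[OF cont(2) elim] isCont_tendsto_compose[OF cont(3) elim] by auto
    then have "(\<lambda>k. R k x) \<longlonglongrightarrow> (A (u x) x - A (u x) x) *\<^sub>R G x + (Z (u x) x - Z (u x) x)"
      unfolding R_def by (intro tendsto_intros)
    then have "(\<lambda>k. norm (R k x)) \<longlonglongrightarrow> 0" by (simp add: tendsto_norm_zero)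
    then have "(\<lambda>k. norm (R k x) powr p) \<longlonglongrightarrow> 0 powr p"
      using p1 by (intro tendsto_powr') auto
    then show ?case by simp
  qed
  have rlim: "(\<lambda>k. \<integral>x. r k x \<partial>M) \<longlonglongrightarrow> 0"
    unfolding r_def using tendsto_mult_right_zero[OF lq] by simp
  have hi: "integrable M h" "integrable M (r k)" and h0: "0 \<le> h x" "0 \<le> r k x" for k x
    using Gi uq iq C unfolding h_def r_def by auto
  have bound': "AE x in M. norm (R k x) powr p \<le> h x + r k x" for k
    using bound by simp
  note small = integral_dominated_plus_small[OF _ _ Rlim bound' hi(1) h0(1) hi(2) h0(2) rlim]
  have R: "\<And>k. integrable M (\<lambda>x. norm (R k x) powr p)" "(\<lambda>k. \<integral>x. norm (R k x) powr p \<partial>M) \<longlonglongrightarrow> 0"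
    by (rule small; simp)+
  let ?\<psi> = "\<lambda>k x. \<Phi> (\<phi> k x) x" and ?H = "\<lambda>x. A (u x) x *\<^sub>R G x + Z (u x) x"
  let ?b = "\<lambda>k x. 2 powr p * (L powr p * norm (grad (\<phi> k) x - G x) powr p + norm (R k x) powr p)"
  have b: "norm (grad (?\<psi> k) x - ?H x) powr p \<le> ?b k x" for k x
  proof -
    have "grad (?\<psi> k) x - ?H x = A (\<phi> k x) x *\<^sub>R (grad (\<phi> k) x - G x) + R k x"
      unfolding grad[OF t] R_def by (simp add: algebra_simps)
    moreover have "norm (A (\<phi> k x) x *\<^sub>R (grad (\<phi> k) x - G x)) powr p \<le> L powr p * norm (grad (\<phi> k) x - G x) powr p"
      using powr_mono2[OF p0 _ mult_right_mono[OF A[of "\<phi> k x" x] norm_ge_zero[of "grad (\<phi> k) x - G x"]]] L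
      by (simp add: powr_mult)
    ultimately show ?thesis
      using order_trans[OF norm_add_powr_le[OF p0] mult_left_mono[OF add_mono[OF _ order_refl]]]
      by (metis powr_ge_zero)
  qed
  have bi: "integrable M (?b k)" for k using i R(1) by auto
  show ?thesis
  proof (rule D1pwI[where \<phi> = ?\<psi>])
    show "test_fun \<Omega> (?\<psi> k)" for k by (rule test[OF t])
    show *: "integrable M (\<lambda>x. norm (grad (?\<psi> k) x - ?H x) powr p)" for k
    proof (rule Bochner_Integration.integrable_bound[OF bi])
      show "AE x in M. norm (norm (grad (?\<psi> k) x - ?H x) powr p) \<le> norm (?b k x)"
        using b by (intro always_eventually allI) (simp add: order_trans[OF b])
    qed (use test_fun_measurable[OF test[OF t]] in auto)
    have "(\<lambda>k. 2 powr p * (L powr p * (\<integral>x. norm (grad (\<phi> k) x - G x) powr p \<partial>M) + (\<integral>x. norm (R k x) powr p \<partial>M)))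
       \<longlonglongrightarrow> 2 powr p * (L powr p * 0 + 0)"
      by (intro tendsto_intros l R(2))
    moreover have "(\<integral>x. ?b k x \<partial>M)
      = 2 powr p * (L powr p * (\<integral>x. norm (grad (\<phi> k) x - G x) powr p \<partial>M) + (\<integral>x. norm (R k x) powr p \<partial>M))" for k
      using i R(1) by simp
    ultimately have blim: "(\<lambda>k. \<integral>x. ?b k x \<partial>M) \<longlonglongrightarrow> 0" by simp
    show "(\<lambda>k. \<integral>x. norm (grad (?\<psi> k) x - ?H x) powr p \<partial>M) \<longlonglongrightarrow> 0"
    proof (rule tendsto_sandwich[OF _ _ tendsto_const blim])
      show "\<forall>\<^sub>F k in sequentially. (\<integral>x. norm (grad (?\<psi> k) x - ?H x) powr p \<partial>M) \<le> (\<integral>x. ?b k x \<partial>M)"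
        by (intro always_eventually allI integral_mono * bi b)
    qed (auto intro!: always_eventually Bochner_Integration.integral_nonneg)
    show "AE x in M. (\<lambda>k. ?\<psi> k x) \<longlonglongrightarrow> \<Phi> (u x) x"
      using ae by eventually_elim (rule isCont_tendsto_compose[OF cont(1)])
  qed auto
qed

lemma weak_solution_M:
  assumes "weak_solution \<Omega> w p q u G" and D: "D1pw \<Omega> w p v H"
  shows "(\<integral>x. norm (G x) powr (p - 2) * (G x \<bullet> H x) \<partial>M) = (\<integral>x. \<bar>u x\<bar> powr (q - 2) * u x * v x \<partial>M)"
proof -
  have [measurable]: "G \<in> borel_measurable lebesgue" "u \<in> borel_measurable lebesgue"
     "H \<in> borel_measurable lebesgue" "v \<in> borel_measurable lebesgue"
    using assms unfolding weak_solution_def D1pw_def by auto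
  have "(LINT x:\<Omega>|lebesgue. norm (G x) powr (p - 2) * (G x \<bullet> H x) * w x)
      = (LINT x:\<Omega>|lebesgue. \<bar>u x\<bar> powr (q - 2) * u x * v x * w x)"
    using assms unfolding weak_solution_def by blast
  then show ?thesis by (simp add: LINT_M)
qed

end

section \<open>Integrability below the critical exponent\<close>

lemma DERIV_damped:
  fixes c \<beta> s :: real
  assumes "0 < c"
  shows "((\<lambda>s. s * (s * s + c) powr (- \<beta>)) has_real_derivative
    (s * s + c) powr (- \<beta>) * (1 - 2 * \<beta> * (s * s) / (s * s + c))) (at s)"
proof -
  have "0 < s * s + c" using assms by (simp add: add_nonneg_pos)
  then show ?thesis
    by (auto intro!: derivative_eq_intros simp: powr_diff field_simps)
qed

context weighted_sobolev
begin

text \<open>The bound on \<beta> keeps the second factor of the derivative in [0, 1], and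
  \<open>c > 0\<close> keeps the first one below \<open>c powr (- \<beta>)\<close>; together they
  give the bounded coefficient of the chain rule.\<close>

lemma D1pw_damped:
  fixes c \<beta> :: real
  assumes D: "D1pw \<Omega> w p u G" and c: "0 < c" and \<beta>: "0 \<le> \<beta>" "\<beta> \<le> 1 / 2"
  shows "D1pw \<Omega> w p (\<lambda>x. u x * (u x * u x + c) powr (- \<beta>))
    (\<lambda>x. ((u x * u x + c) powr (- \<beta>) * (1 - 2 * \<beta> * (u x * u x) / (u x * u x + c))) *\<^sub>R G x)"
proof -
  define A where "A = (\<lambda>(s::real) (x::'a). (s * s + c) powr (- \<beta>) * (1 - 2 * \<beta> * (s * s) / (s * s + c)))"
  have pos: "0 < s * s + c" for s using c by (simp add: add_nonneg_pos)
  have "D1pw \<Omega> w p (\<lambda>x. u x * (u x * u x + c) powr (- \<beta>)) (\<lambda>x. A (u x) x *\<^sub>R G x + 0)"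
  proof (rule D1pw_comp[OF D, where \<Phi> = "\<lambda>s x. s * (s * s + c) powr (- \<beta>)" and Z = "\<lambda>s x. 0" and C = 0
        and L = "c powr (- \<beta>)"])
    fix \<phi> :: "'a \<Rightarrow> real" assume \<phi>: "test_fun \<Omega> \<phi>"
    then have "\<phi> \<in> smooth_alg \<Omega>" unfolding test_fun_def by (auto intro: smooth_alg.base)
    then have "(\<lambda>x. (\<phi> x * \<phi> x + c) powr (- \<beta>)) \<in> smooth_alg \<Omega>"
      using pos by (intro smooth_alg.powr smooth_alg.add smooth_alg.mult smooth_alg_const) auto
    then show "test_fun \<Omega> (\<lambda>x. \<phi> x * (\<phi> x * \<phi> x + c) powr (- \<beta>))"
      by (rule test_fun_mult[OF open_\<Omega> \<phi>])
    show "grad (\<lambda>x. \<phi> x * (\<phi> x * \<phi> x + c) powr (- \<beta>)) x = A (\<phi> x) x *\<^sub>R grad \<phi> x + 0" for x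
      using GDERIV_grad[OF GDERIV_DERIV_compose[OF test_fun_GDERIV[OF open_\<Omega> \<phi>] DERIV_damped[OF c]]]
      unfolding A_def by simp
  next
    fix s x
    have "2 * \<beta> * (s * s) / (s * s + c) \<le> 1" "0 \<le> 2 * \<beta> * (s * s) / (s * s + c)"
      using \<beta> c pos[of s] mult_right_mono[of "2 * \<beta>" 1 "s * s"] by (auto simp: field_simps)
    moreover have "(s * s + c) powr (- \<beta>) \<le> c powr (- \<beta>)"
      using \<beta> c by (intro powr_mono2') auto
    ultimately show "\<bar>A s x\<bar> \<le> c powr (- \<beta>)"
      unfolding A_def using mult_mono[of "(s * s + c) powr (- \<beta>)" "c powr (- \<beta>)" "1 - 2 * \<beta> * (s * s) / (s * s + c)" 1]
      by (simp add: abs_mult)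
  next
    fix s x
    show "isCont (\<lambda>s. s * (s * s + c) powr (- \<beta>)) s" "isCont (\<lambda>s. A s x) s"
      unfolding A_def using pos[of s] by (auto intro!: continuous_intros)
  qed (auto simp: A_def)
  then show ?thesis by (simp add: A_def)
qed

text \<open>For p < 2 the first factor is classically singular at 0; the convention
  \<open>0 powr a = 0\<close> makes both sides vanish there.\<close>

lemma norm_powr_inner: "norm y powr (p - 2) * (y \<bullet> (a *\<^sub>R y)) = a * norm y powr p"
proof (cases "y = 0")
  case False
  then have "norm y powr p = norm y powr (p - 2) * norm y powr 2"
    by (subst powr_add[symmetric]) simp
  also have "norm y powr 2 = y \<bullet> y"
    using False by (simp add: powr_numeral power2_norm_eq_inner)
  finally show ?thesis by simp
qed (use p1 in simp)

lemma abs_powr_mult_self: "1 < r \<Longrightarrow> \<bar>t\<bar> powr (r - 2) * t * (t * a) = \<bar>t\<bar> powr r * (a::real)"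
proof (cases "t = 0")
  case False
  then have "\<bar>t\<bar> powr r = \<bar>t\<bar> powr (r - 2) * \<bar>t\<bar> powr 2"
    by (subst powr_add[symmetric]) simp
  also have "\<bar>t\<bar> powr 2 = t * t"
    using False by (simp add: powr_numeral power2_eq_square)
  finally show ?thesis by simp
qed simp

lemma small_values:
  assumes uq: "integrable M (\<lambda>x. \<bar>u x\<bar> powr q)" and [measurable]: "u \<in> borel_measurable lebesgue"
    and \<epsilon>: "0 < \<epsilon>"
  obtains \<delta> :: real where "0 < \<delta>" "(\<integral>x. (if \<bar>u x\<bar> < \<delta> then \<bar>u x\<bar> powr q else 0) \<partial>M) < \<epsilon>"
proof -
  let ?f = "\<lambda>n x. if \<bar>u x\<bar> < 1 / real (Suc n) then \<bar>u x\<bar> powr q else 0"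
  have "(\<lambda>n. \<integral>x. ?f n x \<partial>M) \<longlonglongrightarrow> (\<integral>x. 0 \<partial>M)"
  proof (rule integral_dominated_convergence[OF _ _ uq])
    show "AE x in M. (\<lambda>n. ?f n x) \<longlonglongrightarrow> 0"
    proof (intro always_eventually allI)
      fix x
      show "(\<lambda>n. ?f n x) \<longlonglongrightarrow> 0"
      proof (cases "u x = 0")
        case False
        then have "\<forall>\<^sub>F n in sequentially. 1 / real (Suc n) < \<bar>u x\<bar>"
          using order_tendstoD(2)[OF LIMSEQ_inverse_real_of_nat] by (simp add: inverse_eq_divide)
        then have "\<forall>\<^sub>F n in sequentially. ?f n x = 0"
          by (rule eventually_mono) (use less_asym in auto)
        then show ?thesis by (rule tendsto_eventually)
      qed simp
    qed
  qed auto
  then have "\<forall>\<^sub>F n in sequentially. (\<integral>x. ?f n x \<partial>M) < \<epsilon>"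
    using \<epsilon> by (intro order_tendstoD) auto
  then show thesis
    using that[of "1 / real (Suc _)"] by (auto simp: eventually_sequentially)
qed

lemma weak_solution_integrable_below:
  assumes ws: "weak_solution \<Omega> w p q u G"
  shows "integrable M (\<lambda>x. \<bar>u x\<bar> powr (q - q / (2 * p)))"
proof -
  have D: "D1pw \<Omega> w p u G" using ws unfolding weak_solution_def by auto
  have [measurable]: "G \<in> borel_measurable lebesgue" "u \<in> borel_measurable lebesgue"
    using D unfolding D1pw_def by auto
  have uq: "integrable M (\<lambda>x. \<bar>u x\<bar> powr q)" by (rule D1pw_sobolev(1)[OF D])
  have Gp: "integrable M (\<lambda>x. norm (G x) powr p)" by (rule D1pwE[OF D])
  have p0: "0 < p" and q0: "0 < q" using p1 pq by auto
  let ?J = "\<integral>x. \<bar>u x\<bar> powr q \<partial>M"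
  \<comment> \<open>The factor 2 is the loss in \<open>W x \<le> 2 * A1 x\<close> below; the power
    of \<open>C0\<close> is Sobolev's inequality raised to \<open>p / q\<close>.\<close>
  define K where "K = 2 * C0 powr (p / q)"
  have K: "0 < K" using C0_pos by (simp add: K_def)
  \<comment> \<open>The threshold makes the Hoelder coefficient of the region of small values at
    most \<open>1 / (2 * K)\<close>, so that its contribution can be absorbed.\<close>
  obtain \<delta> where \<delta>: "0 < \<delta>"
    and I: "(\<integral>x. (if \<bar>u x\<bar> < \<delta> then \<bar>u x\<bar> powr q else 0) \<partial>M) < (1 / (2 * K)) powr (q / (q - p))"
    using small_values[OF uq, of "(1 / (2 * K)) powr (q / (q - p))"] K by auto
  define I where "I = (\<integral>x. (if \<bar>u x\<bar> < \<delta> then \<bar>u x\<bar> powr q else 0) \<partial>M)"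
  have I0: "0 \<le> I" unfolding I_def by (intro Bochner_Integration.integral_nonneg) auto
  have KI: "K * I powr ((q - p) / q) \<le> 1 / 2"
  proof -
    have "I powr ((q - p) / q) \<le> ((1 / (2 * K)) powr (q / (q - p))) powr ((q - p) / q)"
      using I I0 pq q0 unfolding I_def by (intro powr_mono2) auto
    also have "\<dots> = 1 / (2 * K)" using pq q0 K by (simp add: powr_powr)
    finally show ?thesis using K by (simp add: field_simps)
  qed
  define B where "B = (2 * K * \<delta> powr (- 1 / 2) * ?J) powr (q / p)"
  \<comment> \<open>The companion of the test function \<open>u x * W x\<close>: it satisfies
    \<open>\<bar>v c x\<bar> powr p = \<bar>u x\<bar> powr p * W x\<close>, so Sobolev's inequality
    for \<open>v c\<close> needs exactly the energy with weight \<open>W\<close> that the equation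
    provides.\<close>
  define v where "v = (\<lambda>c x. u x * (u x * u x + c) powr (- (1 / (4 * p))))"
  have main: "integrable M (\<lambda>x. \<bar>v c x\<bar> powr q) \<and> (\<integral>x. \<bar>v c x\<bar> powr q \<partial>M) \<le> B" if c: "0 < c" for c :: real
  proof -
    have pos: "0 < u x * u x + c" for x using c by (simp add: add_nonneg_pos)
    define W where "W = (\<lambda>x. (u x * u x + c) powr (- (1 / 4)))"
    define A1 where "A1 = (\<lambda>x. W x * (1 - 2 * (1 / 4) * (u x * u x) / (u x * u x + c)))"
    define A2 where "A2 = (\<lambda>x. (u x * u x + c) powr (- (1 / (4 * p))) * (1 - 2 * (1 / (4 * p)) * (u x * u x) / (u x * u x + c)))"
    have [measurable]: "W \<in> borel_measurable lebesgue" "A1 \<in> borel_measurable lebesgue"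
      "A2 \<in> borel_measurable lebesgue" "v c \<in> borel_measurable lebesgue"
      unfolding W_def A1_def A2_def v_def by measurable
    have D1: "D1pw \<Omega> w p (\<lambda>x. u x * W x) (\<lambda>x. A1 x *\<^sub>R G x)"
      using D1pw_damped[OF D c, of "1/4"] unfolding A1_def W_def by simp
    have D2: "D1pw \<Omega> w p (v c) (\<lambda>x. A2 x *\<^sub>R G x)"
      using D1pw_damped[OF D c, of "1/(4*p)"] p1 unfolding A2_def v_def by simp
    have W0: "0 \<le> W x" and Wc: "W x \<le> c powr (- (1 / 4))" for x
      unfolding W_def using c by (auto intro!: powr_mono2')
    have A1: "W x \<le> 2 * A1 x" "A1 x \<le> W x" for x
    proof -
      define r where "r = u x * u x / (u x * u x + c)"
      have "0 \<le> r" "r \<le> 1"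
        using c pos[of x] unfolding r_def by (auto simp: field_simps)
      then have "0 \<le> W x * r" "W x * r \<le> W x"
        using W0[of x] by (auto simp: mult_left_le)
      moreover have "A1 x = W x - W x * r / 2" unfolding A1_def r_def by (simp add: right_diff_distrib)
      ultimately show "W x \<le> 2 * A1 x" "A1 x \<le> W x" by auto
    qed
    have A2: "\<bar>A2 x\<bar> powr p \<le> W x" for x
    proof -
      let ?t = "2 * (1 / (4 * p)) * (u x * u x) / (u x * u x + c)"
      have "0 \<le> ?t" using pos[of x] p0 by auto
      moreover have "?t \<le> 1"
        using pos[of x] c p1 mult_right_mono[of "2 * (1 / (4 * p))" 1 "u x * u x"]
        by (subst divide_le_eq_1_pos) auto
      ultimately have "\<bar>A2 x\<bar> \<le> (u x * u x + c) powr (- (1 / (4 * p)))"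
        unfolding A2_def by (simp add: abs_mult mult_left_le)
      then have "\<bar>A2 x\<bar> powr p \<le> ((u x * u x + c) powr (- (1 / (4 * p)))) powr p"
        using p0 by (intro powr_mono2) auto
      also have "\<dots> = W x" unfolding W_def using p0 by (simp add: powr_powr)
      finally show ?thesis .
    qed
    have iA1: "integrable M (\<lambda>x. A1 x * norm (G x) powr p)"
    proof (rule Bochner_Integration.integrable_bound)
      show "integrable M (\<lambda>x. c powr (- (1 / 4)) * norm (G x) powr p)" using Gp by simp
      show "AE x in M. norm (A1 x * norm (G x) powr p) \<le> norm (c powr (- (1 / 4)) * norm (G x) powr p)"
      proof (intro always_eventually allI)
        fix x
        have "\<bar>A1 x\<bar> \<le> c powr (- (1 / 4))" using A1[of x] W0[of x] Wc[of x] by linarith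
        then show "norm (A1 x * norm (G x) powr p) \<le> norm (c powr (- (1 / 4)) * norm (G x) powr p)"
          by (simp add: abs_mult mult_right_mono)
      qed
    qed measurable
    have weak: "(\<integral>x. A1 x * norm (G x) powr p \<partial>M) = (\<integral>x. \<bar>u x\<bar> powr q * W x \<partial>M)"
      using weak_solution_M[OF ws D1] p1 pq unfolding norm_powr_inner by (simp add: abs_powr_mult_self)
    let ?V = "\<integral>x. \<bar>v c x\<bar> powr q \<partial>M"
    have vi: "integrable M (\<lambda>x. \<bar>v c x\<bar> powr q)" by (rule D1pw_sobolev(1)[OF D2])
    have V0: "0 \<le> ?V" by (intro Bochner_Integration.integral_nonneg) auto
    have "(\<integral>x. norm (A2 x *\<^sub>R G x) powr p \<partial>M) \<le> (\<integral>x. 2 * (A1 x * norm (G x) powr p) \<partial>M)"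
    proof (rule integral_mono)
      show "integrable M (\<lambda>x. norm (A2 x *\<^sub>R G x) powr p)" by (rule D1pwE[OF D2])
      show "norm (A2 x *\<^sub>R G x) powr p \<le> 2 * (A1 x * norm (G x) powr p)" for x
        using mult_right_mono[OF order_trans[OF A2[of x] A1(1)[of x]] powr_ge_zero[of "norm (G x)" p]]
        by (simp add: powr_mult)
    qed (use iA1 in simp)
    then have A2i: "(\<integral>x. norm (A2 x *\<^sub>R G x) powr p \<partial>M) \<le> 2 * (\<integral>x. \<bar>u x\<bar> powr q * W x \<partial>M)"
      using weak by simp
    have "?V powr (p / q) \<le> (C0 * (\<integral>x. norm (A2 x *\<^sub>R G x) powr p \<partial>M) powr (q / p)) powr (p / q)"
      using D1pw_sobolev(2)[OF D2] V0 p0 q0 by (intro powr_mono2) auto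
    also have "\<dots> = C0 powr (p / q) * (\<integral>x. norm (A2 x *\<^sub>R G x) powr p \<partial>M)"
      using C0_pos p0 q0 by (simp add: powr_mult powr_powr Bochner_Integration.integral_nonneg)
    also have "\<dots> \<le> K * (\<integral>x. \<bar>u x\<bar> powr q * W x \<partial>M)"
      using mult_left_mono[OF A2i, of "C0 powr (p / q)"] unfolding K_def by simp
    finally have V1: "?V powr (p / q) \<le> K * (\<integral>x. \<bar>u x\<bar> powr q * W x \<partial>M)" .
    let ?f = "\<lambda>x. if \<bar>u x\<bar> < \<delta> then \<bar>u x\<bar> powr q else 0"
    let ?a = "(q - p) / q" and ?b = "p / q"
    have fi: "integrable M ?f" by (rule Bochner_Integration.integrable_bound[OF uq]) auto
    have ab: "0 < ?a" "0 < ?b" "?a + ?b = 1" using pq p0 q0 by (auto simp: field_simps)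
    note Hoelder = Hoelder_interpolation[OF fi vi _ _ ab]
    have split: "\<bar>u x\<bar> powr q * W x \<le> ?f x powr ?a * (\<bar>v c x\<bar> powr q) powr ?b + \<delta> powr (- 1 / 2) * \<bar>u x\<bar> powr q" for x
    proof (cases "\<bar>u x\<bar> < \<delta>")
      case True
      have "\<bar>v c x\<bar> powr p = \<bar>u x\<bar> powr p * W x"
        unfolding v_def W_def using p0 by (simp add: abs_mult powr_mult powr_powr)
      moreover have "(\<bar>u x\<bar> powr q) powr ?a = \<bar>u x\<bar> powr (q - p)" "(\<bar>v c x\<bar> powr q) powr ?b = \<bar>v c x\<bar> powr p"
        using q0 by (simp_all add: powr_powr)
      moreover have "\<bar>u x\<bar> powr q = \<bar>u x\<bar> powr (q - p) * \<bar>u x\<bar> powr p"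
        by (simp add: powr_add[symmetric])
      ultimately show ?thesis using True by simp
    next
      case False
      have "\<delta> * \<delta> \<le> u x * u x"
        using False \<delta> mult_mono[of \<delta> "\<bar>u x\<bar>" \<delta> "\<bar>u x\<bar>"] by (simp add: abs_mult[symmetric])
      then have "W x \<le> (\<delta> * \<delta>) powr (- (1 / 4))"
        unfolding W_def using c \<delta> by (intro powr_mono2') auto
      also have "\<dots> = \<delta> powr (- 1 / 2)"
        using \<delta> by (simp add: powr_mult powr_add[symmetric])
      finally have "W x * \<bar>u x\<bar> powr q \<le> \<delta> powr (- 1 / 2) * \<bar>u x\<bar> powr q"
        by (rule mult_right_mono) simp
      then show ?thesis using False by (simp add: mult.commute)
    qed
    have Wi: "integrable M (\<lambda>x. \<bar>u x\<bar> powr q * W x)"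
    proof (rule Bochner_Integration.integrable_bound)
      show "integrable M (\<lambda>x. \<bar>u x\<bar> powr q * c powr (- (1 / 4)))" using uq by simp
      show "AE x in M. norm (\<bar>u x\<bar> powr q * W x) \<le> norm (\<bar>u x\<bar> powr q * c powr (- (1 / 4)))"
        using W0 Wc by (auto simp: mult_left_mono)
    qed measurable
    have "(\<integral>x. \<bar>u x\<bar> powr q * W x \<partial>M)
      \<le> (\<integral>x. ?f x powr ?a * (\<bar>v c x\<bar> powr q) powr ?b + \<delta> powr (- 1 / 2) * \<bar>u x\<bar> powr q \<partial>M)"
      using Hoelder(1) uq by (intro integral_mono[OF Wi _ split]) auto
    also have "\<dots> = (\<integral>x. ?f x powr ?a * (\<bar>v c x\<bar> powr q) powr ?b \<partial>M) + \<delta> powr (- 1 / 2) * ?J"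
      using Hoelder(1) uq by simp
    also have "\<dots> \<le> I powr ?a * ?V powr ?b + \<delta> powr (- 1 / 2) * ?J"
      using Hoelder(2) unfolding I_def by simp
    finally have "?V powr ?b \<le> K * (I powr ?a * ?V powr ?b + \<delta> powr (- 1 / 2) * ?J)"
      using V1 K mult_left_mono order_trans by (meson less_imp_le)
    also have "\<dots> \<le> 1 / 2 * ?V powr ?b + K * \<delta> powr (- 1 / 2) * ?J"
      using mult_right_mono[OF KI powr_ge_zero[of ?V ?b]] by (simp add: algebra_simps)
    \<comment> \<open>Half of \<open>?V powr ?b\<close> moves to the left. The remaining bound does
      not involve \<open>c\<close>, which is what the limit requires.\<close>
    finally have "?V powr ?b \<le> 2 * K * \<delta> powr (- 1 / 2) * ?J" by simp
    then have "(?V powr ?b) powr (q / p) \<le> B"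
      unfolding B_def using p0 q0 by (intro powr_mono2) auto
    then show ?thesis using vi V0 p0 q0 by (simp add: powr_powr)
  qed
  \<comment> \<open>As \<open>c\<close> tends to 0, the damping becomes
    \<open>\<bar>u x\<bar> powr (- 1 / (2 * p))\<close>; hence the exponent
    \<open>q - q / (2 * p)\<close>.\<close>
  have lim: "AE x in M. (\<lambda>n. \<bar>v (1 / real (Suc n)) x\<bar> powr q) \<longlonglongrightarrow> \<bar>u x\<bar> powr (q - q / (2 * p))"
  proof (intro always_eventually allI)
    fix x
    show "(\<lambda>n. \<bar>v (1 / real (Suc n)) x\<bar> powr q) \<longlonglongrightarrow> \<bar>u x\<bar> powr (q - q / (2 * p))"
    proof (cases "u x = 0")
      case False
      have "(\<lambda>n. 1 / real (Suc n)) \<longlonglongrightarrow> 0"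
        using LIMSEQ_inverse_real_of_nat by (simp add: inverse_eq_divide)
      then have "(\<lambda>n. \<bar>v (1 / real (Suc n)) x\<bar> powr q) \<longlonglongrightarrow> \<bar>u x * (u x * u x + 0) powr (- (1 / (4 * p)))\<bar> powr q"
        unfolding v_def using False q0 by (intro tendsto_intros tendsto_powr') auto
      also have "\<bar>u x * (u x * u x + 0) powr (- (1 / (4 * p)))\<bar> powr q = \<bar>u x\<bar> powr (q - q / (2 * p))"
      proof -
        have "u x * u x = \<bar>u x\<bar> powr 2" using False by (simp add: powr_numeral power2_eq_square)
        then have "(u x * u x + 0) powr (- (1 / (4 * p))) = \<bar>u x\<bar> powr (2 * (- (1 / (4 * p))))"
          by (simp only: add_0_right powr_powr)
        then have "\<bar>u x * (u x * u x + 0) powr (- (1 / (4 * p)))\<bar> powr q = (\<bar>u x\<bar> powr 1 * \<bar>u x\<bar> powr (2 * (- (1 / (4 * p))))) powr q"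
          by (simp only: abs_mult) simp
        also have "\<dots> = \<bar>u x\<bar> powr ((1 + 2 * (- (1 / (4 * p)))) * q)"
          by (simp only: powr_add[symmetric] powr_powr)
        also have "(1 + 2 * (- (1 / (4 * p)))) * q = q - q / (2 * p)"
          using p0 by (simp add: field_simps)
        finally show ?thesis .
      qed
      finally show ?thesis .
    qed (simp add: v_def)
  qed
  show ?thesis
    by (rule Fatou_real(1)[OF _ _ _ _ lim, where c = "\<lambda>n. B" and C = B]) (use main in auto)
qed

end

section \<open>The De Giorgi iteration step\<close>

text \<open>Fast geometric convergence: \<open>r\<close> is so small that the gain of
  \<open>r powr \<alpha>\<close> per step cancels the growth \<open>B\<close>, and \<eta> so small
  that the leftover \<open>K * \<eta> powr \<alpha>\<close> supplies the next factor
  \<open>r\<close>.\<close>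

lemma superlinear_recursion:
  fixes Y :: "nat \<Rightarrow> real"
  assumes Y0: "\<And>n. 0 \<le> Y n" and rec: "\<And>n. Y (Suc n) \<le> K * B ^ n * Y n powr (1 + \<alpha>)"
    and pos: "0 \<le> K" "0 \<le> B" "0 < \<alpha>" "0 < r" "0 \<le> \<eta>"
    and \<eta>: "K * \<eta> powr \<alpha> \<le> r" and r: "B * r powr \<alpha> \<le> 1" and init: "Y 0 \<le> \<eta>"
  shows "Y n \<le> \<eta> * r ^ n"
proof (induction n)
  case (Suc n)
  have "Y (Suc n) \<le> K * B ^ n * (\<eta> * r ^ n) powr (1 + \<alpha>)"
    using Suc Y0 pos by (intro order_trans[OF rec] mult_left_mono powr_mono2) auto
  also have "(\<eta> * r ^ n) powr (1 + \<alpha>) = (\<eta> * r ^ n) * (\<eta> powr \<alpha> * (r powr \<alpha>) ^ n)"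
  proof -
    have "(r ^ n) powr \<alpha> = (r powr \<alpha>) ^ n"
      using pos by (simp add: powr_realpow[symmetric] powr_powr mult.commute)
    then show ?thesis using pos by (cases "\<eta> = 0") (simp_all add: powr_add powr_mult)
  qed
  also have "K * B ^ n * ((\<eta> * r ^ n) * (\<eta> powr \<alpha> * (r powr \<alpha>) ^ n))
      = (\<eta> * r ^ n) * ((K * \<eta> powr \<alpha>) * (B * r powr \<alpha>) ^ n)"
    by (simp add: power_mult_distrib)
  also have "\<dots> \<le> (\<eta> * r ^ n) * (r * 1)"
    using pos \<eta> r by (intro mult_left_mono mult_mono power_le_one) auto
  finally show ?case by (simp add: mult_ac)
qed (use init in simp)

section \<open>The smooth step: scalar inequalities\<close>

definition soft_step :: "nat \<Rightarrow> real \<Rightarrow> real" where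
  "soft_step m t = t ^ (2 * m) / (1 + t ^ (2 * m))"

lemma soft_step_denominator: "1 \<le> 1 + t ^ (2 * m)" for t :: real
  by (simp add: power_mult)

lemma soft_step_bounds: "0 \<le> soft_step m t" "soft_step m t \<le> 1" "soft_step m t \<le> t ^ (2 * m)"
proof -
  let ?a = "t ^ (2 * m)"
  have a: "0 \<le> ?a" by (simp add: power_mult)
  have "?a / (1 + ?a) \<le> 1 / 1 * ?a" unfolding times_divide_eq_left mult_1
    using a by (intro divide_left_mono) (auto intro!: add_pos_nonneg)
  then show "soft_step m t \<le> t ^ (2 * m)" by (simp add: soft_step_def)
  have pos: "0 < 1 + ?a" using a by linarith
  show "0 \<le> soft_step m t" "soft_step m t \<le> 1"
    unfolding soft_step_def using a pos by (auto simp: divide_le_eq_1_pos)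
qed

lemma soft_step_0: "m \<ge> 1 \<Longrightarrow> soft_step m 0 = 0"
  by (simp add: soft_step_def)

lemma soft_step_mono:
  assumes "\<bar>s\<bar> \<le> \<bar>t\<bar>" shows "soft_step m s \<le> soft_step m t"
proof -
  have "s ^ (2 * m) \<le> t ^ (2 * m)"
    using power_mono[OF assms, of "2 * m"] by (simp add: power_even_abs)
  then show ?thesis
    unfolding soft_step_def using soft_step_denominator[of s m] soft_step_denominator[of t m]
    by (intro frac_le_eq[THEN iffD2] divide_nonpos_pos mult_pos_pos) (auto simp: algebra_simps)
qed

lemma soft_step_ge_half:
  assumes "1 \<le> \<bar>t\<bar>" shows "1 / 2 \<le> soft_step m t"
  using soft_step_mono[of 1 t m] assms by (simp add: soft_step_def)

text \<open>With a = t^(2m) this is (1 + a)^k \<le> 2^k (1 + a^k). It is the substitute for raising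
  the level in De Giorgi's argument: a steeper step is controlled by a power of the flatter
  one.\<close>

lemma soft_step_mult: "soft_step (m * k) t \<le> 2 ^ k * soft_step m t ^ k"
proof -
  let ?a = "t ^ (2 * m)"
  have a: "0 \<le> ?a" by (simp add: power_mult)
  have "(1 + ?a) ^ k \<le> (2 * max 1 ?a) ^ k" using a by (intro power_mono) auto
  also have "\<dots> = 2 ^ k * max 1 ?a ^ k" by (simp add: power_mult_distrib)
  also have "max 1 ?a ^ k \<le> 1 + ?a ^ k" using a by (auto simp: max_def)
  finally have *: "(1 + ?a) ^ k \<le> 2 ^ k * (1 + ?a ^ k)" by simp
  have "soft_step (m * k) t = ?a ^ k / (1 + ?a ^ k)"
    by (simp add: soft_step_def power_mult[symmetric] mult.assoc)
  also have "\<dots> \<le> 2 ^ k * (?a ^ k / (1 + ?a) ^ k)"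
    using mult_left_mono[OF *, of "?a ^ k"] a
    by (simp add: divide_simps add_pos_nonneg mult.commute mult.left_commute) 
  finally show ?thesis by (simp add: soft_step_def power_divide)
qed

lemma DERIV_soft_step:
  "((\<lambda>t. t * soft_step m t) has_real_derivative soft_step m t * (1 + 2 * real m / (1 + t ^ (2 * m)))) (at t)"
proof -
  have pos: "1 + t ^ (2 * m) > 0" using soft_step_denominator[of t m] by linarith
  define d where "d = 2 * real m * t ^ (2 * m - 1)"
  have td: "t * d = 2 * real m * t ^ (2 * m)"
    unfolding d_def by (cases m) auto
  have da: "((\<lambda>t. t ^ (2 * m)) has_real_derivative d) (at t)"
    unfolding d_def by (auto intro!: derivative_eq_intros)
  then have db: "((\<lambda>t. 1 + t ^ (2 * m)) has_real_derivative 0 + d) (at t)"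
    by (intro DERIV_add DERIV_const)
  show ?thesis
    unfolding soft_step_def
  proof (rule DERIV_cong[OF DERIV_mult[OF DERIV_ident DERIV_divide[OF da db]]])
    have "(d * (1 + t ^ (2 * m)) - t ^ (2 * m) * (0 + d)) / ((1 + t ^ (2 * m)) * (1 + t ^ (2 * m))) * t
      = t * d / ((1 + t ^ (2 * m)) * (1 + t ^ (2 * m)))"
      by (simp add: algebra_simps)
    then show "1 * (t ^ (2 * m) / (1 + t ^ (2 * m))) +
      (d * (1 + t ^ (2 * m)) - t ^ (2 * m) * (0 + d)) / ((1 + t ^ (2 * m)) * (1 + t ^ (2 * m))) * t
      = t ^ (2 * m) / (1 + t ^ (2 * m)) * (1 + 2 * real m / (1 + t ^ (2 * m)))"
      unfolding td using pos by (simp add: distrib_left mult_ac)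
  qed (use pos in auto)
qed

text \<open>Young's inequality with the coefficient 1/2 wanted for absorption, obtained by comparing
  \<open>Y\<close> with \<open>X / 2\<close>.\<close>

lemma powr_mult_le_half:
  fixes X Y p :: real
  assumes "0 \<le> X" "0 \<le> Y" "1 \<le> p"
  shows "X powr (p - 1) * Y \<le> X powr p / 2 + 2 powr (p - 1) * Y powr p"
proof (cases "Y \<le> X / 2")
  case True
  then have "X powr (p - 1) * Y \<le> X powr (p - 1) * (X / 2)" by (intro mult_left_mono) auto
  also have "\<dots> = X powr p / 2" using assms by (cases "X = 0") (auto simp: powr_diff)
  finally show ?thesis by (simp add: add_increasing2)
next
  case False
  then have "X powr (p - 1) * Y \<le> (2 * Y) powr (p - 1) * Y"
    using assms by (intro mult_right_mono powr_mono2) auto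
  also have "\<dots> = 2 powr (p - 1) * Y powr p"
    using assms False by (simp add: powr_mult powr_diff)
  finally show ?thesis by (simp add: add_increasing)
qed

section \<open>The energy estimate relative to a barrier\<close>

context weighted_sobolev
begin

text \<open>The step vanishes to order 2m at 0, so below the floor \<open>g0\<close> it gains the
  missing power \<open>q - p\<close>; above the floor its bound 1 suffices. This yields the growth
  condition on \<open>Z\<close> in \<open>D1pw_comp\<close>.\<close>

lemma soft_step_powr_le:
  fixes s g g0 :: real
  assumes g: "0 < g0" "g0 \<le> g" and m: "q - p \<le> 2 * real m"
  shows "soft_step m (s / g) * \<bar>s\<bar> powr p \<le> g0 powr (p - q) * \<bar>s\<bar> powr q"
proof (cases "s = 0")
  case False
  have "soft_step m (s / g) \<le> soft_step m (s / g0)"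
    using g by (intro soft_step_mono) (auto simp: abs_divide intro!: divide_left_mono)
  also have "\<dots> \<le> (\<bar>s\<bar> / g0) powr (q - p)"
  proof (cases "g0 \<le> \<bar>s\<bar>")
    case True
    then have "1 \<le> (\<bar>s\<bar> / g0) powr (q - p)" using g pq by (intro ge_one_powr_ge_zero) auto
    then show ?thesis using soft_step_bounds(2)[of m "s / g0"] by linarith
  next
    case le: False
    have "soft_step m (s / g0) \<le> \<bar>s / g0\<bar> ^ (2 * m)"
      using soft_step_bounds(3)[of m "s / g0"] by (subst power_even_abs) auto
    also have "\<dots> = (\<bar>s\<bar> / g0) powr (2 * real m)"
      using False g by (subst powr_realpow[symmetric]) (auto simp: abs_divide)
    also have "\<dots> \<le> (\<bar>s\<bar> / g0) powr (q - p)"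
      using False g le m by (intro powr_mono') auto
    finally show ?thesis .
  qed
  finally have "soft_step m (s / g) * \<bar>s\<bar> powr p \<le> (\<bar>s\<bar> / g0) powr (q - p) * \<bar>s\<bar> powr p"
    by (intro mult_right_mono) auto
  also have "\<dots> = g0 powr (p - q) * \<bar>s\<bar> powr q"
    using g False by (simp add: powr_divide powr_diff)
  finally show ?thesis .
qed (use pq p1 in simp)

text \<open>The function is g F(\<phi>/g) with F(t) = t \<open>soft_step m t\<close>, so its
  gradient is F' grad \<phi> + (F - t F') grad g. With grad g = g b the last term becomes a multiple
  of \<phi> b, and \<open>g\<close> remains only inside the ratio.\<close>

lemma grad_soft_step:
  assumes \<phi>: "test_fun \<Omega> \<phi>" and g: "GDERIV g x :> g x *\<^sub>R b" "\<And>x. 0 < g x"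
  shows "grad (\<lambda>x. \<phi> x * soft_step m (\<phi> x / g x)) x
    = (soft_step m (\<phi> x / g x) * (1 + 2 * real m / (1 + (\<phi> x / g x) ^ (2 * m)))) *\<^sub>R grad \<phi> x
      + (- (soft_step m (\<phi> x / g x) * (2 * real m / (1 + (\<phi> x / g x) ^ (2 * m))) * \<phi> x)) *\<^sub>R b"
proof (rule GDERIV_grad)
  have gx: "g x > 0" using g(2) .
  define t where "t = (\<lambda>x. \<phi> x * inverse (g x))"
  define D where "D = \<phi> x *\<^sub>R (- (inverse (g x))\<^sup>2 *\<^sub>R (g x *\<^sub>R b)) + inverse (g x) *\<^sub>R grad \<phi> x"
  define F' where "F' = soft_step m (t x) * (1 + 2 * real m / (1 + t x ^ (2 * m)))"
  have "GDERIV t x :> D"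
    unfolding t_def D_def using gx
    by (intro GDERIV_mult test_fun_GDERIV[OF open_\<Omega> \<phi>] GDERIV_inverse[OF g(1)]) simp
  from GDERIV_mult[OF g(1) GDERIV_DERIV_compose[OF this DERIV_soft_step, of m]]
  have "GDERIV (\<lambda>x. g x * (t x * soft_step m (t x))) x
      :> g x *\<^sub>R F' *\<^sub>R D + (t x * soft_step m (t x)) *\<^sub>R g x *\<^sub>R b"
    unfolding F'_def .
  moreover have "(\<lambda>x. g x * (t x * soft_step m (t x))) = (\<lambda>x. \<phi> x * soft_step m (\<phi> x / g x))"
    using less_imp_neq[OF g(2)] by (auto simp: t_def divide_inverse)
  moreover have "g x *\<^sub>R F' *\<^sub>R D + (t x * soft_step m (t x)) *\<^sub>R g x *\<^sub>R b
    = F' *\<^sub>R grad \<phi> x + (- (soft_step m (t x) * (2 * real m / (1 + t x ^ (2 * m))) * \<phi> x)) *\<^sub>R b"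
  proof -
    have "g x *\<^sub>R F' *\<^sub>R D + (t x * soft_step m (t x)) *\<^sub>R g x *\<^sub>R b
      = (g x * inverse (g x) * F') *\<^sub>R grad \<phi> x
       + (- (F' * \<phi> x * (g x * inverse (g x))\<^sup>2) + t x * g x * soft_step m (t x)) *\<^sub>R b"
      unfolding D_def by (simp add: algebra_simps power2_eq_square)
    also have "g x * inverse (g x) = 1" using gx by simp
    also have "t x * g x = \<phi> x" using gx by (simp add: t_def)
    finally show ?thesis unfolding F'_def by (simp add: algebra_simps)
  qed
  moreover have "t x = \<phi> x / g x" by (simp add: t_def divide_inverse)
  ultimately show "GDERIV (\<lambda>x. \<phi> x * soft_step m (\<phi> x / g x)) x
    :> (soft_step m (\<phi> x / g x) * (1 + 2 * real m / (1 + (\<phi> x / g x) ^ (2 * m)))) *\<^sub>R grad \<phi> x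
      + (- (soft_step m (\<phi> x / g x) * (2 * real m / (1 + (\<phi> x / g x) ^ (2 * m))) * \<phi> x)) *\<^sub>R b"
    unfolding F'_def by simp
qed

lemma test_fun_soft_step:
  assumes \<phi>: "test_fun \<Omega> \<phi>" and g: "g \<in> smooth_alg \<Omega>" "\<And>x. 0 < g x"
  shows "test_fun \<Omega> (\<lambda>x. \<phi> x * soft_step m (\<phi> x / g x))"
proof (rule test_fun_mult[OF open_\<Omega> \<phi>])
  have "\<phi> \<in> smooth_alg \<Omega>" using \<phi> unfolding test_fun_def by (auto intro: smooth_alg.base)
  \<comment> \<open>Division is expressed by \<open>powr - 1\<close>, the form of a reciprocal
    available in \<open>smooth_alg\<close>.\<close>
  then have t: "(\<lambda>x. (\<phi> x * g x powr - 1) ^ (2 * m)) \<in> smooth_alg \<Omega>"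
    using g by (intro smooth_alg_power smooth_alg.mult smooth_alg.powr) auto
  have pos: "0 < 1 + (\<phi> x * g x powr - 1) ^ (2 * m)" for x
    using soft_step_denominator[of "\<phi> x * g x powr - 1" m] by linarith
  have "(\<lambda>x. (\<phi> x * g x powr - 1) ^ (2 * m) * (1 + (\<phi> x * g x powr - 1) ^ (2 * m)) powr - 1) \<in> smooth_alg \<Omega>"
    using pos by (intro smooth_alg.mult[OF t] smooth_alg.powr smooth_alg.add smooth_alg_const t) auto
  moreover have "(\<lambda>x. (\<phi> x * g x powr - 1) ^ (2 * m) * (1 + (\<phi> x * g x powr - 1) ^ (2 * m)) powr - 1)
     = (\<lambda>x. soft_step m (\<phi> x / g x))"
  proof
    fix x
    have "\<phi> x * g x powr - 1 = \<phi> x / g x"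
      using g(2)[of x] by (simp add: powr_minus divide_inverse)
    with pos[of x] show "(\<phi> x * g x powr - 1) ^ (2 * m) * (1 + (\<phi> x * g x powr - 1) ^ (2 * m)) powr - 1 = soft_step m (\<phi> x / g x)"
      by (simp only: soft_step_def powr_minus powr_one divide_inverse less_imp_le)
  qed
  ultimately show "(\<lambda>x. soft_step m (\<phi> x / g x)) \<in> smooth_alg \<Omega>" by simp
qed

text \<open>A Caccioppoli estimate for the test function \<open>u x * h x\<close>, followed by
  Sobolev's inequality. The second integral on the right is the error from differentiating the
  barrier. The essential point is the polynomial dependence of the constant on
  \<open>m\<close>.\<close>

lemma soft_step_energy:
  fixes g :: "'a \<Rightarrow> real" and b :: "'a \<Rightarrow> 'a"
  assumes ws: "weak_solution \<Omega> w p q u G"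
    and g: "g \<in> smooth_alg \<Omega>" "\<And>x. GDERIV g x :> g x *\<^sub>R b x" "\<And>x. g0 \<le> g x" "0 < g0"
    and b: "\<And>x. norm (b x) \<le> B"
    and meas[measurable]: "g \<in> borel_measurable lebesgue" "b \<in> borel_measurable lebesgue"
    and m: "q - p \<le> 2 * real m"
  defines "h \<equiv> (\<lambda>x. soft_step m (u x / g x))"
  shows "integrable M (\<lambda>x. h x * (\<bar>u x\<bar> * norm (b x)) powr p)"
    and "(\<integral>x. \<bar>u x\<bar> powr q * h x powr q \<partial>M)
      \<le> C0 * (4 powr p * (1 + 2 * real m) powr (p + 1) *
          ((\<integral>x. \<bar>u x\<bar> powr q * h x \<partial>M) + (\<integral>x. h x * (\<bar>u x\<bar> * norm (b x)) powr p \<partial>M))) powr (q / p)"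
proof -
  have D: "D1pw \<Omega> w p u G" using ws unfolding weak_solution_def by auto
  have [measurable]: "G \<in> borel_measurable lebesgue" "u \<in> borel_measurable lebesgue"
    using D unfolding D1pw_def by auto
  have uq: "integrable M (\<lambda>x. \<bar>u x\<bar> powr q)" by (rule D1pw_sobolev(1)[OF D])
  have Gp: "integrable M (\<lambda>x. norm (G x) powr p)" by (rule D1pwE[OF D])
  have p0: "0 < p" and q0: "0 < q" using p1 pq by auto
  have gpos: "0 < g x" for x using g(3,4) less_le_trans by blast
  have B0: "0 \<le> B" using order_trans[OF norm_ge_zero b] .
  \<comment> \<open>With t = s/g this is t times the derivative of the step at t, the part of the
    gradient caused by the step itself.\<close>
  define \<theta> where "\<theta> = (\<lambda>s x. soft_step m (s / g x) * (2 * real m / (1 + (s / g x) ^ (2 * m))))"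
  have \<theta>: "0 \<le> \<theta> s x" "\<theta> s x \<le> 2 * real m * soft_step m (s / g x)" for s x
  proof -
    have "0 \<le> 2 * real m / (1 + (s / g x) ^ (2 * m))" "2 * real m / (1 + (s / g x) ^ (2 * m)) \<le> 2 * real m"
      using soft_step_denominator[of "s / g x" m] divide_left_mono[of 1 "1 + (s / g x) ^ (2 * m)" "2 * real m"]
      by (simp_all add: less_le_trans[OF zero_less_one])
    then show "0 \<le> \<theta> s x" "\<theta> s x \<le> 2 * real m * soft_step m (s / g x)"
      using mult_left_mono[OF _ soft_step_bounds(1)[of m "s / g x"]] mult_nonneg_nonneg[OF soft_step_bounds(1)[of m "s / g x"]]
      unfolding \<theta>_def by (simp_all only: mult.commute[of "soft_step m (s / g x)"])
  qed
  define A where "A = (\<lambda>s x. soft_step m (s / g x) + \<theta> s x)"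
  define Z where "Z = (\<lambda>s x. (- (\<theta> s x * s)) *\<^sub>R b x)"
  have pos: "1 + (s / g x) ^ (2 * m) \<noteq> 0" for s x
    using soft_step_denominator[of "s / g x" m] by linarith
  have \<theta>p: "\<theta> s x powr p \<le> (2 * real m) powr p * soft_step m (s / g x)" for s x
  proof -
    have "\<theta> s x powr p \<le> (2 * real m * soft_step m (s / g x)) powr p"
      using \<theta>[of s x] p0 by (intro powr_mono2) auto
    also have "\<dots> = (2 * real m) powr p * soft_step m (s / g x) powr p"
      using soft_step_bounds(1) by (simp add: powr_mult)
    also have "soft_step m (s / g x) powr p \<le> soft_step m (s / g x) powr 1"
      using soft_step_bounds(1,2)[of m "s / g x"] p1 by (intro powr_mono') auto
    finally show ?thesis using soft_step_bounds(1)[of m "s / g x"] by (simp add: mult_left_mono)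
  qed
  have Zp: "norm (Z s x) powr p \<le> (2 * real m) powr p * (soft_step m (s / g x) * (\<bar>s\<bar> * norm (b x)) powr p)" for s x
  proof -
    have "norm (Z s x) powr p = \<theta> s x powr p * (\<bar>s\<bar> * norm (b x)) powr p"
      unfolding Z_def using \<theta>(1)[of s x] by (simp add: abs_mult powr_mult)
    also have "\<dots> \<le> (2 * real m) powr p * soft_step m (s / g x) * (\<bar>s\<bar> * norm (b x)) powr p"
      by (intro mult_right_mono \<theta>p) auto
    finally show ?thesis by (simp add: mult.assoc)
  qed
  have hub: "soft_step m (s / g x) * (\<bar>s\<bar> * norm (b x)) powr p \<le> B powr p * g0 powr (p - q) * \<bar>s\<bar> powr q" for s x
  proof -
    have "soft_step m (s / g x) * (\<bar>s\<bar> * norm (b x)) powr p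
        = (soft_step m (s / g x) * \<bar>s\<bar> powr p) * norm (b x) powr p"
      by (simp add: powr_mult)
    also have "\<dots> \<le> (g0 powr (p - q) * \<bar>s\<bar> powr q) * B powr p"
      using b[of x] p0 soft_step_bounds(1) by (intro mult_mono soft_step_powr_le g m powr_mono2) auto
    finally show ?thesis by (simp add: mult_ac)
  qed
  have Zq: "norm (Z s x) powr p \<le> (2 * real m) powr p * (B powr p * g0 powr (p - q)) * \<bar>s\<bar> powr q" for s x
    using order_trans[OF Zp mult_left_mono[OF hub]] by (simp add: mult.assoc)
  define v where "v = (\<lambda>x. u x * h x)"
  define H where "H = (\<lambda>x. A (u x) x *\<^sub>R G x + Z (u x) x)"
  have DH: "D1pw \<Omega> w p v H"
    unfolding v_def H_def h_def
  proof (rule D1pw_comp[OF D, where \<Phi> = "\<lambda>s x. s * soft_step m (s / g x)"])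
    show "test_fun \<Omega> (\<lambda>x. \<phi> x * soft_step m (\<phi> x / g x))" if "test_fun \<Omega> \<phi>" for \<phi>
      by (rule test_fun_soft_step[OF that g(1) gpos])
    show "grad (\<lambda>x. \<phi> x * soft_step m (\<phi> x / g x)) x = A (\<phi> x) x *\<^sub>R grad \<phi> x + Z (\<phi> x) x"
      if "test_fun \<Omega> \<phi>" for \<phi> x
      using grad_soft_step[OF that g(2) gpos, where m = m] unfolding A_def Z_def \<theta>_def by (simp add: distrib_left)
    show "\<bar>A s x\<bar> \<le> 1 + 2 * real m" for s x
    proof -
      have "2 * real m * soft_step m (s / g x) \<le> 2 * real m * 1"
        using soft_step_bounds(2) by (intro mult_left_mono) auto
      then show ?thesis
        using \<theta>[of s x] soft_step_bounds(1,2)[of m "s / g x"] unfolding A_def by simp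
    qed
    show "norm (Z s x) powr p \<le> ((2 * real m) powr p * (B powr p * g0 powr (p - q))) * \<bar>s\<bar> powr q" for s x
      by (rule Zq)
    show "isCont (\<lambda>s. s * soft_step m (s / g x)) s" "isCont (\<lambda>s. A s x) s" "isCont (\<lambda>s. Z s x) s" for s x
      using pos less_imp_neq[OF gpos]
      unfolding A_def Z_def \<theta>_def soft_step_def by (auto intro!: continuous_intros)
    fix f :: "'a \<Rightarrow> real" assume [measurable]: "f \<in> borel_measurable lebesgue"
    show "(\<lambda>x. f x * soft_step m (f x / g x)) \<in> borel_measurable lebesgue"
      "(\<lambda>x. A (f x) x) \<in> borel_measurable lebesgue" "(\<lambda>x. Z (f x) x) \<in> borel_measurable lebesgue"
      unfolding A_def Z_def \<theta>_def soft_step_def by measurable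
  qed
  have [measurable]: "h \<in> borel_measurable lebesgue" unfolding h_def soft_step_def by measurable
  have h01: "0 \<le> h x" "h x \<le> 1" for x unfolding h_def by (rule soft_step_bounds)+
  have [measurable]: "H \<in> borel_measurable lebesgue" using DH unfolding D1pw_def by auto
  have Hp: "integrable M (\<lambda>x. norm (H x) powr p)" by (rule D1pwE[OF DH])
  let ?E = "\<lambda>x. h x * (\<bar>u x\<bar> * norm (b x)) powr p"
  show Ei: "integrable M ?E"
  proof (rule Bochner_Integration.integrable_bound)
    show "integrable M (\<lambda>x. B powr p * g0 powr (p - q) * \<bar>u x\<bar> powr q)" using uq by simp
    show "AE x in M. norm (?E x) \<le> norm (B powr p * g0 powr (p - q) * \<bar>u x\<bar> powr q)"
      using hub[of "u _"] h01 unfolding h_def by (intro always_eventually allI) simp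
  qed measurable
  have uh: "integrable M (\<lambda>x. \<bar>u x\<bar> powr q * h x)"
    by (rule Bochner_Integration.integrable_bound[OF uq]) (use h01 in \<open>auto simp: mult_left_le\<close>)
  have hG: "integrable M (\<lambda>x. h x * norm (G x) powr p)"
    by (rule Bochner_Integration.integrable_bound[OF Gp]) (use h01 in \<open>auto simp: mult_left_le_one_le\<close>)
  let ?K = "\<lambda>x. norm (G x) powr (p - 2) * (G x \<bullet> H x)"
  have G1: "norm (G x) powr (p - 2) * norm (G x) = norm (G x) powr (p - 1)" for x
    by (cases "G x = 0") (auto simp: powr_diff powr_numeral power2_eq_square)
  have KG: "\<bar>?K x\<bar> \<le> norm (G x) powr (p - 1) * norm (H x)" for x
    using mult_left_mono[OF Cauchy_Schwarz_ineq2[of "G x" "H x"] powr_ge_zero[of "norm (G x)" "p - 2"]]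
    by (simp add: abs_mult G1 mult.assoc[symmetric])
  \<comment> \<open>A Bochner integral defaults to 0 for non-integrable functions, so integrability
    must precede any use of the weak equation in estimates.\<close>
  have Ki: "integrable M ?K"
  proof (rule Bochner_Integration.integrable_bound)
    show "integrable M (\<lambda>x. norm (G x) powr p / 2 + 2 powr (p - 1) * norm (H x) powr p)"
      using Gp Hp by simp
    show "AE x in M. norm (?K x) \<le> norm (norm (G x) powr p / 2 + 2 powr (p - 1) * norm (H x) powr p)"
      using order_trans[OF KG powr_mult_le_half] p1 by (intro always_eventually allI) (simp add: add_nonneg_nonneg)
  qed measurable
  have weak: "(\<integral>x. ?K x \<partial>M) = (\<integral>x. \<bar>u x\<bar> powr q * h x \<partial>M)"
    using weak_solution_M[OF ws DH] p1 pq unfolding v_def by (simp add: abs_powr_mult_self)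
  \<comment> \<open>The Young term \<open>?t * ?X powr p / 2\<close> is absorbed by the \<theta>
    part of \<open>?K\<close>, not by its \<open>h\<close> part. The left-hand side therefore keeps
    coefficient 1, and \<open>m\<close> enters the error only linearly.\<close>
  have "h x * norm (G x) powr p \<le> ?K x + 2 powr p * (2 * real m) * ?E x" for x
  proof -
    let ?X = "norm (G x)" and ?Y = "\<bar>u x\<bar> * norm (b x)" and ?t = "\<theta> (u x) x"
    have "?K x = (h x + ?t) * ?X powr p - norm (G x) powr (p - 2) * (?t * u x * (G x \<bullet> b x))"
    proof -
      have "?K x = norm (G x) powr (p - 2) * (G x \<bullet> (A (u x) x *\<^sub>R G x))
         - norm (G x) powr (p - 2) * (?t * u x * (G x \<bullet> b x))"
        unfolding H_def Z_def by (simp add: inner_diff_right right_diff_distrib)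
      then show ?thesis unfolding norm_powr_inner unfolding A_def h_def .
    qed
    moreover have "norm (G x) powr (p - 2) * (?t * u x * (G x \<bullet> b x)) \<le> ?t * (?X powr (p - 1) * ?Y)"
    proof -
      have "u x * (G x \<bullet> b x) \<le> \<bar>u x\<bar> * (norm (G x) * norm (b x))"
        by (rule order_trans[OF abs_ge_self]) (simp add: abs_mult mult_left_mono Cauchy_Schwarz_ineq2)
      then have "norm (G x) powr (p - 2) * (?t * (u x * (G x \<bullet> b x)))
          \<le> norm (G x) powr (p - 2) * (?t * (\<bar>u x\<bar> * (norm (G x) * norm (b x))))"
        using \<theta>(1) by (intro mult_left_mono) auto
      then show ?thesis unfolding G1[symmetric] by (simp add: mult_ac)
    qed
    moreover have "?t * (?X powr (p - 1) * ?Y) \<le> ?t * (?X powr p / 2 + 2 powr (p - 1) * ?Y powr p)"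
      using p1 by (intro mult_left_mono powr_mult_le_half \<theta>(1)) auto
    moreover have "?t * (2 powr (p - 1) * ?Y powr p) \<le> 2 powr p * (2 * real m) * ?E x"
    proof -
      have "?t * (2 powr (p - 1) * ?Y powr p) \<le> (2 * real m * h x) * (2 powr p * ?Y powr p)"
      proof (rule mult_mono)
        show "?t \<le> 2 * real m * h x" using \<theta>(2) unfolding h_def .
        show "2 powr (p - 1) * ?Y powr p \<le> 2 powr p * ?Y powr p"
          by (intro mult_right_mono powr_mono) auto
      qed (use h01 in auto)
      then show ?thesis by (simp add: mult_ac)
    qed
    moreover have "0 \<le> ?t * ?X powr p" using \<theta>(1) by simp
    ultimately show ?thesis by (simp add: algebra_simps)
  qed
  then have "(\<integral>x. h x * norm (G x) powr p \<partial>M) \<le> (\<integral>x. ?K x + 2 powr p * (2 * real m) * ?E x \<partial>M)"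
    using hG Ki Ei by (intro integral_mono) auto
  then have hG_le: "(\<integral>x. h x * norm (G x) powr p \<partial>M)
      \<le> (\<integral>x. \<bar>u x\<bar> powr q * h x \<partial>M) + 2 powr p * (2 * real m) * (\<integral>x. ?E x \<partial>M)"
    using Ki Ei weak by simp
  let ?c = "2 powr p * (1 + 2 * real m) powr p"
  have "norm (H x) powr p \<le> ?c * (h x * norm (G x) powr p + ?E x)" for x
  proof -
    have "norm (A (u x) x *\<^sub>R G x) powr p \<le> (1 + 2 * real m) powr p * (h x * norm (G x) powr p)"
    proof -
      have "\<bar>A (u x) x\<bar> \<le> (1 + 2 * real m) * h x"
        using \<theta>[of "u x" x] h01[of x] unfolding A_def h_def by (simp add: algebra_simps)
      then have "\<bar>A (u x) x\<bar> powr p \<le> ((1 + 2 * real m) * h x) powr p" using p0 by (intro powr_mono2) auto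
      also have "\<dots> = (1 + 2 * real m) powr p * h x powr p" using h01 by (simp add: powr_mult)
      also have "h x powr p \<le> h x powr 1" using h01 p1 by (intro powr_mono') auto
      finally have "\<bar>A (u x) x\<bar> powr p \<le> (1 + 2 * real m) powr p * h x" using h01 by (simp add: mult_left_mono)
      then have "\<bar>A (u x) x\<bar> powr p * norm (G x) powr p \<le> (1 + 2 * real m) powr p * h x * norm (G x) powr p"
        by (rule mult_right_mono) simp
      then show ?thesis by (simp add: powr_mult mult.assoc)
    qed
    moreover have "norm (Z (u x) x) powr p \<le> (1 + 2 * real m) powr p * ?E x"
    proof -
      have "(2 * real m) powr p \<le> (1 + 2 * real m) powr p" using p0 by (intro powr_mono2) auto
      then show ?thesis
        using order_trans[OF Zp[of "u x" x] mult_right_mono] h01[of x] unfolding h_def by simp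
    qed
    ultimately have "norm (H x) powr p \<le> 2 powr p * ((1 + 2 * real m) powr p * (h x * norm (G x) powr p) + (1 + 2 * real m) powr p * ?E x)"
      unfolding H_def using p0 by (intro order_trans[OF norm_add_powr_le mult_left_mono[OF add_mono]]) auto
    then show ?thesis by (simp add: algebra_simps)
  qed
  then have "(\<integral>x. norm (H x) powr p \<partial>M) \<le> (\<integral>x. ?c * (h x * norm (G x) powr p + ?E x) \<partial>M)"
    using hG Ei Hp by (intro integral_mono) auto
  also have "\<dots> = ?c * ((\<integral>x. h x * norm (G x) powr p \<partial>M) + (\<integral>x. ?E x \<partial>M))"
    using hG Ei by simp
  also have "\<dots> \<le> ?c * ((\<integral>x. \<bar>u x\<bar> powr q * h x \<partial>M) + 2 powr p * (2 * real m) * (\<integral>x. ?E x \<partial>M) + (\<integral>x. ?E x \<partial>M))"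
    using hG_le by (intro mult_left_mono add_right_mono) auto
  also have "\<dots> \<le> ?c * (2 powr p * (1 + 2 * real m) * ((\<integral>x. \<bar>u x\<bar> powr q * h x \<partial>M) + (\<integral>x. ?E x \<partial>M)))"
  proof (rule mult_left_mono)
    have E0: "0 \<le> (\<integral>x. ?E x \<partial>M)" "0 \<le> (\<integral>x. \<bar>u x\<bar> powr q * h x \<partial>M)"
      using h01 by (auto intro!: Bochner_Integration.integral_nonneg)
    have c1: "1 \<le> (2::real) powr p" using p0 by (simp add: ge_one_powr_ge_zero)
    have "1 * 1 \<le> 2 powr p * (1 + 2 * real m)" using c1 by (intro mult_mono) auto
    then have "(\<integral>x. \<bar>u x\<bar> powr q * h x \<partial>M) \<le> 2 powr p * (1 + 2 * real m) * (\<integral>x. \<bar>u x\<bar> powr q * h x \<partial>M)"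
      using E0(2) mult_right_mono by fastforce
    moreover have "2 powr p * (2 * real m) * (\<integral>x. ?E x \<partial>M) + (\<integral>x. ?E x \<partial>M) \<le> 2 powr p * (1 + 2 * real m) * (\<integral>x. ?E x \<partial>M)"
      using mult_right_mono[OF c1 E0(1)] by (simp add: algebra_simps)
    ultimately show "(\<integral>x. \<bar>u x\<bar> powr q * h x \<partial>M) + 2 powr p * (2 * real m) * (\<integral>x. ?E x \<partial>M) + (\<integral>x. ?E x \<partial>M)
      \<le> 2 powr p * (1 + 2 * real m) * ((\<integral>x. \<bar>u x\<bar> powr q * h x \<partial>M) + (\<integral>x. ?E x \<partial>M))"
      by (simp add: distrib_left)
  qed simp
  also have "\<dots> = 4 powr p * (1 + 2 * real m) powr (p + 1) * ((\<integral>x. \<bar>u x\<bar> powr q * h x \<partial>M) + (\<integral>x. ?E x \<partial>M))"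
  proof -
    have "(4::real) powr p = 2 powr p * 2 powr p" using powr_mult[of 2 2 p] by simp
    then show ?thesis by (simp add: powr_add mult_ac)
  qed
  finally have "(\<integral>x. norm (H x) powr p \<partial>M) powr (q / p) \<le> (4 powr p * (1 + 2 * real m) powr (p + 1) *
      ((\<integral>x. \<bar>u x\<bar> powr q * h x \<partial>M) + (\<integral>x. ?E x \<partial>M))) powr (q / p)"
    using p0 q0 by (intro powr_mono2 Bochner_Integration.integral_nonneg) auto
  then have "(\<integral>x. \<bar>v x\<bar> powr q \<partial>M) \<le> C0 * (4 powr p * (1 + 2 * real m) powr (p + 1) *
      ((\<integral>x. \<bar>u x\<bar> powr q * h x \<partial>M) + (\<integral>x. ?E x \<partial>M))) powr (q / p)"
    using order_trans[OF D1pw_sobolev(2)[OF DH] mult_left_mono] C0_pos by simp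
  moreover have "\<bar>v x\<bar> powr q = \<bar>u x\<bar> powr q * h x powr q" for x
    unfolding v_def using h01 by (simp add: abs_mult powr_mult)
  ultimately show "(\<integral>x. \<bar>u x\<bar> powr q * h x powr q \<partial>M)
      \<le> C0 * (4 powr p * (1 + 2 * real m) powr (p + 1) *
          ((\<integral>x. \<bar>u x\<bar> powr q * h x \<partial>M) + (\<integral>x. ?E x \<partial>M))) powr (q / p)"
    by simp
qed

end

section \<open>Decay\<close>

lemma norm_le_one_plus_inner_powr:
  fixes x :: "'a::euclidean_space"
  shows "norm x \<le> (1 + x \<bullet> x) powr (1 / 2)"
proof -
  have "norm x = sqrt (x \<bullet> x)" by (rule norm_eq_sqrt_inner)
  also have "\<dots> \<le> sqrt (1 + x \<bullet> x)" by simp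
  also have "\<dots> = (1 + x \<bullet> x) powr (1 / 2)" by (rule powr_half_sqrt[symmetric]) simp
  finally show ?thesis .
qed

text \<open>Written as the barrier times its logarithmic gradient, the form expected by
  \<open>grad_soft_step\<close>.\<close>

lemma GDERIV_barrier:
  fixes x :: "'a::euclidean_space" and \<kappa> \<delta> k :: real
  assumes "0 < \<delta>"
  defines "N \<equiv> \<lambda>x::'a. 1 + x \<bullet> x"
  shows "GDERIV (\<lambda>x. k * (N x powr (- \<kappa> / 2) + \<delta>)) x
    :> (k * (N x powr (- \<kappa> / 2) + \<delta>)) *\<^sub>R ((- \<kappa> * N x powr (- \<kappa> / 2 - 1) / (N x powr (- \<kappa> / 2) + \<delta>)) *\<^sub>R x)"
proof -
  have N: "0 < N x" unfolding N_def by (simp add: add_pos_nonneg)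
  have "GDERIV N x :> 2 *\<^sub>R x"
    unfolding gderiv_def N_def by (auto intro!: derivative_eq_intros simp: inner_commute)
  from GDERIV_DERIV_compose[OF this has_real_derivative_powr[OF N, of "- \<kappa> / 2"]]
  have "GDERIV (\<lambda>x. N x powr (- \<kappa> / 2)) x :> (- \<kappa> / 2 * N x powr (- \<kappa> / 2 - 1)) *\<^sub>R 2 *\<^sub>R x" .
  from GDERIV_mult[OF GDERIV_const GDERIV_add[OF this GDERIV_const], of k \<delta>]
  have "GDERIV (\<lambda>x. k * (N x powr (- \<kappa> / 2) + \<delta>)) x
    :> k *\<^sub>R ((- \<kappa> / 2 * N x powr (- \<kappa> / 2 - 1)) *\<^sub>R 2 *\<^sub>R x + 0) + (N x powr (- \<kappa> / 2) + \<delta>) *\<^sub>R 0" .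
  moreover have "N x powr (- \<kappa> / 2) + \<delta> \<noteq> 0"
    using assms(1) powr_ge_zero[of "N x" "- \<kappa> / 2"] by linarith
  ultimately show ?thesis by (simp add: mult.assoc)
qed

text \<open>Trading \<open>g\<close> for \<open>\<bar>s\<bar>\<close> is free where g \<le>
  \<bar>s\<bar>. Elsewhere the square root of the step is at most (\<bar>s\<bar>/g)^m and pays for
  it; the other square root is kept for the iteration.\<close>

lemma soft_step_half_power:
  fixes s g r :: real
  assumes g: "0 < g" and r: "0 \<le> r" "r \<le> real m" and m: "1 \<le> m"
  shows "soft_step m (s / g) * g powr r \<le> soft_step m (s / g) powr (1 / 2) * \<bar>s\<bar> powr r"
proof (cases "s = 0")
  case True
  then show ?thesis using soft_step_0[OF m] by simp
next
  case False
  let ?h = "soft_step m (s / g)"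
  have h: "?h = ?h powr (1 / 2) * ?h powr (1 / 2)"
    using soft_step_bounds(1)[of m "s / g"] by (simp add: powr_add[symmetric])
  have "?h powr (1 / 2) * g powr r \<le> \<bar>s\<bar> powr r"
  proof (cases "g \<le> \<bar>s\<bar>")
    case True
    have "?h powr (1 / 2) \<le> 1"
      using soft_step_bounds[of m "s / g"] powr_mono2[of "1/2" ?h 1] by simp
    then have "?h powr (1 / 2) * g powr r \<le> 1 * \<bar>s\<bar> powr r"
      using True g r by (intro mult_mono powr_mono2) auto
    then show ?thesis by simp
  next
    case le: False
    have "?h powr (1 / 2) \<le> ((s / g) ^ (2 * m)) powr (1 / 2)"
      using soft_step_bounds[of m "s / g"] by (intro powr_mono2) auto
    also have "(s / g) ^ (2 * m) = (\<bar>s\<bar> / g) powr (2 * real m)"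
    proof -
      have "(s / g) ^ (2 * m) = \<bar>s / g\<bar> ^ (2 * m)" by (subst power_even_abs) auto
      also have "\<dots> = (\<bar>s\<bar> / g) ^ (2 * m)" using g by (simp add: abs_divide)
      also have "\<dots> = (\<bar>s\<bar> / g) powr real (2 * m)"
        using False g by (intro powr_realpow[symmetric]) auto
      finally show ?thesis by simp
    qed
    also have "((\<bar>s\<bar> / g) powr (2 * real m)) powr (1 / 2) = (\<bar>s\<bar> / g) powr real m"
      by (simp add: powr_powr)
    also have "\<dots> \<le> (\<bar>s\<bar> / g) powr r"
      using False g le r by (intro powr_mono') auto
    finally have "?h powr (1 / 2) * g powr r \<le> (\<bar>s\<bar> / g) powr r * g powr r"
      by (intro mult_right_mono) auto
    then show ?thesis using g by (simp add: powr_divide)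
  qed
  then have "?h powr (1 / 2) * (?h powr (1 / 2) * g powr r) \<le> ?h powr (1 / 2) * \<bar>s\<bar> powr r"
    by (intro mult_left_mono) auto
  then show ?thesis using h by (simp add: mult.assoc[symmetric])
qed


section \<open>The iteration and the decay rate\<close>

context weighted_sobolev
begin

lemma soft_step_powr_integrable:
  assumes uq: "integrable M (\<lambda>x. \<bar>u x\<bar> powr q)"
    and [measurable]: "u \<in> borel_measurable lebesgue" "v \<in> borel_measurable lebesgue"
  shows "integrable M (\<lambda>x. \<bar>u x\<bar> powr q * soft_step m (v x) powr q)"
    and "\<bar>u x\<bar> powr q * soft_step m (v x) powr q \<le> \<bar>u x\<bar> powr q"
proof -
  show le: "\<bar>u x\<bar> powr q * soft_step m (v x) powr q \<le> \<bar>u x\<bar> powr q" for x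
  proof -
    have "soft_step m (v x) powr q \<le> 1 powr q"
      using soft_step_bounds p1 pq by (intro powr_mono2) auto
    then show ?thesis by (simp add: mult_left_le)
  qed
  show "integrable M (\<lambda>x. \<bar>u x\<bar> powr q * soft_step m (v x) powr q)"
    by (rule Bochner_Integration.integrable_bound[OF uq]) (use le in \<open>auto simp: soft_step_def\<close>)
qed

text \<open>Dominated convergence with majorant \<open>\<bar>u x\<bar> powr q\<close>, since the
  step at \<open>v x / k\<close> tends to 0 pointwise. This starts the iteration; a large
  \<open>k\<close> acts as a high initial level.\<close>

lemma soft_step_integral_small:
  assumes uq: "integrable M (\<lambda>x. \<bar>u x\<bar> powr q)"
    and [measurable]: "u \<in> borel_measurable lebesgue" "v \<in> borel_measurable lebesgue"
    and m: "1 \<le> m" and \<epsilon>: "0 < \<epsilon>"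
  obtains k :: real where "1 \<le> k" "(\<integral>x. \<bar>u x\<bar> powr q * soft_step m (v x / k) powr q \<partial>M) < \<epsilon>"
proof -
  let ?f = "\<lambda>n x. \<bar>u x\<bar> powr q * soft_step m (v x / real (Suc n)) powr q"
  have "(\<lambda>n. \<integral>x. ?f n x \<partial>M) \<longlonglongrightarrow> (\<integral>x. 0 \<partial>M)"
  proof (rule integral_dominated_convergence[OF _ _ uq])
    show "AE x in M. (\<lambda>n. ?f n x) \<longlonglongrightarrow> 0"
    proof (intro always_eventually allI)
      fix x
      have t: "(\<lambda>n. v x / real (Suc n)) \<longlonglongrightarrow> 0"
        using tendsto_mult[OF tendsto_const[of "v x"] LIMSEQ_inverse_real_of_nat] unfolding divide_inverse mult_zero_right .
      have z: "(0::real) ^ (2 * m) = 0" using m by simp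
      have p: "(\<lambda>n. (v x / real (Suc n)) ^ (2 * m)) \<longlonglongrightarrow> 0"
        using tendsto_power[OF t, of "2 * m"] unfolding z .
      have "(\<lambda>n. soft_step m (v x / real (Suc n))) \<longlonglongrightarrow> 0"
        by (rule tendsto_sandwich[OF _ _ tendsto_const p]) (simp_all add: soft_step_bounds del: of_nat_Suc)
      then have "(\<lambda>n. soft_step m (v x / real (Suc n)) powr q) \<longlonglongrightarrow> 0 powr q"
        using p1 pq soft_step_bounds(1) by (intro tendsto_powr' tendsto_const) auto
      from tendsto_mult[OF tendsto_const[of "\<bar>u x\<bar> powr q"] this]
      show "(\<lambda>n. ?f n x) \<longlonglongrightarrow> 0" by simp
    qed
    show "AE x in M. norm (?f n x) \<le> \<bar>u x\<bar> powr q" for n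
      using soft_step_powr_integrable(2)[OF uq, of "\<lambda>x. v x / real (Suc n)"]
      by (intro always_eventually allI) simp
  qed (auto simp: soft_step_def)
  then have "\<forall>\<^sub>F n in sequentially. (\<integral>x. ?f n x \<partial>M) < \<epsilon>"
    using \<epsilon> by (intro order_tendstoD(2)) auto
  then obtain n where "(\<integral>x. ?f n x \<partial>M) < \<epsilon>"
    by (meson eventually_sequentially order_refl)
  then show thesis using that[of "real (Suc n)"] by auto
qed

text \<open>The floor \<open>\<delta>\<close> keeps the barrier away from \<open>0\<close>, which makes the test functions of the
  iteration admissible: the approximants of \<open>u\<close> converge in \<open>L\<^sup>q\<close> only. The constant \<open>k\<close> does not
  depend on \<open>\<delta>\<close>.\<close>
lemma decay_with_floor:
  fixes \<kappa> \<tau> :: real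
  assumes ws: "weak_solution \<Omega> w p q u G" and \<kappa>: "0 < \<kappa>" and \<tau>: "p / q < \<tau>" "\<tau> < 1"
    and exponent: "p + p / \<kappa> = (1 - \<tau>) * (q - q / (2 * p)) + \<tau> * q"
  obtains k where "0 < k" "\<And>\<delta>. 0 < \<delta> \<Longrightarrow> AE x in M. \<bar>u x\<bar> \<le> k * ((1 + x \<bullet> x) powr (- \<kappa> / 2) + \<delta>)"
proof -
  have D: "D1pw \<Omega> w p u G" using ws unfolding weak_solution_def by auto
  have [measurable]: "u \<in> borel_measurable lebesgue"
    using D unfolding D1pw_def by auto
  have uq: "integrable M (\<lambda>x. \<bar>u x\<bar> powr q)" by (rule D1pw_sobolev(1)[OF D])
  have p0: "0 < p" and q0: "0 < q" using p1 pq by auto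
  have \<tau>0: "0 < \<tau>" using \<tau>(1) p0 q0 divide_pos_pos less_trans by blast
  define s where "s = q - q / (2 * p)"
  have us: "integrable M (\<lambda>x. \<bar>u x\<bar> powr s)"
    unfolding s_def by (rule weak_solution_integrable_below[OF ws])
  define J Is where "J = (\<integral>x. \<bar>u x\<bar> powr q \<partial>M)" and "Is = (\<integral>x. \<bar>u x\<bar> powr s \<partial>M)"
  define N where "N = (\<lambda>x::'a. 1 + x \<bullet> x)"
  have N1: "1 \<le> N x" for x unfolding N_def by simp
  have nN: "norm x \<le> N x powr (1 / 2)" for x
    unfolding N_def by (rule norm_le_one_plus_inner_powr)
  have Ncont: "continuous_on UNIV N" unfolding N_def by (intro continuous_intros)
  have [measurable]: "N \<in> borel_measurable lebesgue" by (rule continuous_measurable_M[OF Ncont])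
  have id_meas[measurable]: "(\<lambda>x::'a. x) \<in> borel_measurable lebesgue"
    by (rule continuous_measurable_M) (rule continuous_on_id)
  \<comment> \<open>Large enough that even the square root of the next step is bounded by the
    \<open>q\<close>-th power of the current one, see \<open>hstep\<close>.\<close>
  obtain Q :: nat where Q: "2 * q \<le> real Q" using real_arch_simple by blast
  have Q2: "2 \<le> Q" using Q p1 pq by linarith
  \<comment> \<open>The three lower bounds serve, in order, the vanishing of the step at 0,
    \<open>soft_step_half_power\<close> with exponent \<open>p / \<kappa>\<close>, and
    \<open>soft_step_energy\<close>.\<close>
  obtain m0 :: nat where m0: "max 1 (max (p / \<kappa>) (q - p)) \<le> real m0" using real_arch_simple by blast
  define mm where "mm = (\<lambda>j. m0 * Q ^ j)"
  have mm_ge: "real m0 \<le> real (mm j)" for j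
  proof -
    have "1 \<le> real Q ^ j" using Q2 by (intro one_le_power) auto
    then show ?thesis unfolding mm_def using mult_left_mono[of 1 "real Q ^ j" "real m0"] by simp
  qed
  \<comment> \<open>The Hoelder factors of the reaction term and of the barrier term.
    \<open>K\<close> contains \<open>E + 1\<close> so as to stay positive even if \<open>u\<close>
    vanishes almost everywhere.\<close>
  define E where "E = J powr (1 - \<tau>) + \<kappa> powr p * Is powr (1 - \<tau>)"
  define K where "K = C0 * (4 powr p * (1 + 2 * real m0 * Q) powr (p + 1) * (2 ^ Q * (E + 1))) powr (q / p)"
  define B where "B = real Q powr ((p + 1) * (q / p))"
  \<comment> \<open>The superlinear excess of the recursion, positive because \<tau> > p/q.\<close>
  define \<alpha> where "\<alpha> = \<tau> * (q / p) - 1"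
  have E0: "0 \<le> E" unfolding E_def by simp
  have K0: "0 < K"
  proof -
    have "0 < 1 + 2 * real m0 * Q" by (simp add: add_pos_nonneg)
    then have "0 < 4 powr p * (1 + 2 * real m0 * Q) powr (p + 1) * (2 ^ Q * (E + 1))"
      using E0 by (intro mult_pos_pos) auto
    then have "(4 powr p * (1 + 2 * real m0 * Q) powr (p + 1) * (2 ^ Q * (E + 1))) powr (q / p) > 0"
      by (intro powr_gt_zero[THEN iffD2]) linarith
    then show ?thesis unfolding K_def by (intro mult_pos_pos C0_pos)
  qed
  have B1: "1 < B" unfolding B_def using Q2 p0 q0 by (intro gr_one_powr) auto
  have \<alpha>0: "0 < \<alpha>" using \<tau>(1) p0 q0 unfolding \<alpha>_def by (simp add: field_simps)
  \<comment> \<open>\<open>r\<close> solves \<open>B * r powr \<alpha> = 1\<close> and \<eta> below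
    solves \<open>K * \<eta> powr \<alpha> = r\<close>, the equality cases in
    \<open>superlinear_recursion\<close>.\<close>
  define r where "r = B powr (- 1 / \<alpha>)"
  have r0: "0 < r" unfolding r_def using B1 by simp
  have r1: "r < 1" unfolding r_def using B1 \<alpha>0 by (intro powr_less_one) auto
  have rB: "B * r powr \<alpha> \<le> 1"
  proof -
    have "- 1 / \<alpha> * \<alpha> = - 1" using \<alpha>0 by simp
    then have "r powr \<alpha> = B powr - 1" unfolding r_def powr_powr by simp
    then show ?thesis using B1 by (simp add: powr_minus)
  qed
  define \<eta> where "\<eta> = (r / K) powr (1 / \<alpha>)"
  have \<eta>0: "0 < \<eta>" unfolding \<eta>_def using r0 K0 by simp
  have K\<eta>: "K * \<eta> powr \<alpha> \<le> r" unfolding \<eta>_def using r0 K0 \<alpha>0 by (simp add: powr_powr)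
  have m01: "1 \<le> m0" using m0 by auto
  \<comment> \<open>Chosen before \<delta>: this integral uses the barrier without floor, which is
    smaller and gives a larger step, so its bound covers every \<delta>.\<close>
  obtain k where k1: "1 \<le> k"
    and n: "(\<integral>x. \<bar>u x\<bar> powr q * soft_step m0 (u x * N x powr (\<kappa> / 2) / k) powr q \<partial>M) < \<eta>"
    using soft_step_integral_small[OF uq _ _ m01 \<eta>0, of "\<lambda>x. u x * N x powr (\<kappa> / 2)"] by auto
  have "AE x in M. \<bar>u x\<bar> \<le> k * (N x powr (- \<kappa> / 2) + \<delta>)" if \<delta>: "0 < \<delta>" for \<delta>
  proof -
    define g where "g = (\<lambda>x. k * (N x powr (- \<kappa> / 2) + \<delta>))"
    define b where "b = (\<lambda>x. (- \<kappa> * N x powr (- \<kappa> / 2 - 1) / (N x powr (- \<kappa> / 2) + \<delta>)) *\<^sub>R x)"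
    have Nd: "0 < N x powr (- \<kappa> / 2) + \<delta>" for x
      using \<delta> powr_ge_zero[of "N x" "- \<kappa> / 2"] by linarith
    have [measurable]: "g \<in> borel_measurable lebesgue" "b \<in> borel_measurable lebesgue"
      unfolding g_def b_def by measurable
    have g_smooth: "g \<in> smooth_alg \<Omega>"
      unfolding g_def N_def
      by (intro smooth_alg.mult smooth_alg.add smooth_alg.powr smooth_alg_const smooth_alg_inner_self)
        (simp add: add_pos_nonneg)
    have gb: "GDERIV g x :> g x *\<^sub>R b x" for x
      using GDERIV_barrier[OF \<delta>, of k \<kappa> x] unfolding g_def b_def N_def .
    have g0: "\<delta> \<le> g x" for x
    proof -
      have "1 * \<delta> \<le> k * (N x powr (- \<kappa> / 2) + \<delta>)"
        using k1 \<delta> by (intro mult_mono) auto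
      then show ?thesis unfolding g_def by simp
    qed
    have gN: "N x powr (- \<kappa> / 2) \<le> g x" for x
      using mult_mono[OF k1, of "N x powr (- \<kappa> / 2)" "N x powr (- \<kappa> / 2) + \<delta>"] \<delta> k1 unfolding g_def by simp
    have gpos: "0 < g x" for x using g0[of x] \<delta> by linarith
    have bN: "norm (b x) \<le> \<kappa> * N x powr (- 1 / 2)" for x
    proof -
      have "norm (b x) = \<kappa> * (N x powr (- \<kappa> / 2 - 1) / (N x powr (- \<kappa> / 2) + \<delta>)) * norm x"
        unfolding b_def using \<kappa> Nd[of x] by (simp add: abs_mult)
      also have "\<dots> \<le> \<kappa> * (N x powr (- \<kappa> / 2 - 1) / N x powr (- \<kappa> / 2)) * N x powr (1 / 2)"
        using \<kappa> \<delta> N1[of x] nN[of x]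
        by (intro mult_mono divide_left_mono mult_pos_pos mult_nonneg_nonneg Nd) auto
      also have "\<dots> = \<kappa> * N x powr ((- \<kappa> / 2 - 1) - (- \<kappa> / 2) + 1 / 2)"
        using N1[of x] by (simp only: powr_diff powr_add mult.assoc)
      finally show ?thesis by simp
    qed
    have bB: "norm (b x) \<le> \<kappa>" for x
    proof -
      have "N x powr (- 1 / 2) \<le> N x powr 0" using N1[of x] by (intro powr_mono) auto
      then have "\<kappa> * N x powr (- 1 / 2) \<le> \<kappa> * 1" using N1[of x] \<kappa> by (intro mult_left_mono) auto
      then show ?thesis using bN[of x] by simp
    qed
    \<comment> \<open>The logarithmic gradient is at most \<kappa> times
      \<open>N x powr (- 1 / 2)\<close>, itself a power of the floorless profile;
      \<open>k \<ge> 1\<close> permits replacing that profile by \<open>g\<close>.\<close>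
    have bg: "norm (b x) powr p \<le> \<kappa> powr p * g x powr (p / \<kappa>)" for x
    proof -
      have "N x powr (- 1 / 2) = (N x powr (- \<kappa> / 2)) powr (1 / \<kappa>)" using \<kappa> by (simp add: powr_powr)
      also have "\<dots> \<le> g x powr (1 / \<kappa>)" using gN \<kappa> by (intro powr_mono2) auto
      finally have "norm (b x) \<le> \<kappa> * g x powr (1 / \<kappa>)"
        using bN[of x] \<kappa> mult_left_mono[of _ _ \<kappa>] order_trans less_imp_le by metis
      then have "norm (b x) powr p \<le> (\<kappa> * g x powr (1 / \<kappa>)) powr p" using p0 by (intro powr_mono2) auto
      then show ?thesis using \<kappa> by (simp add: powr_mult powr_powr)
    qed
    define h where "h = (\<lambda>j x. soft_step (mm j) (u x / g x))"
    have [measurable]: "h j \<in> borel_measurable lebesgue" for j unfolding h_def soft_step_def by measurable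
    have h01: "0 \<le> h j x" "h j x \<le> 1" for j x unfolding h_def by (rule soft_step_bounds)+
    have hq1: "h j x powr q \<le> 1" for j x
      using powr_mono2[OF _ h01, of q j x] q0 by simp
    have hstep: "h (Suc j) x powr (1 / 2) \<le> 2 ^ Q * h j x powr q" for j x
    proof -
      have "h (Suc j) x \<le> 2 ^ Q * h j x ^ Q"
        using soft_step_mult[of "mm j" Q "u x / g x"] unfolding h_def mm_def by (simp add: mult_ac)
      then have "h (Suc j) x powr (1 / 2) \<le> (2 ^ Q * h j x ^ Q) powr (1 / 2)"
        using h01 by (intro powr_mono2) auto
      also have "\<dots> = (2 ^ Q) powr (1 / 2) * (h j x ^ Q) powr (1 / 2)"
        using h01 by (simp add: powr_mult)
      also have "\<dots> \<le> 2 ^ Q * h j x powr q"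
      proof (rule mult_mono)
        show "(2 ^ Q) powr (1 / 2) \<le> (2::real) ^ Q"
          using powr_mono[of "1/2" 1 "(2::real) ^ Q"] by simp
        show "(h j x ^ Q) powr (1 / 2) \<le> h j x powr q"
        proof (cases "h j x = 0")
          case False
          then have "(h j x ^ Q) powr (1 / 2) = h j x powr (real Q / 2)"
            using h01[of j x] by (simp add: powr_realpow[symmetric] powr_powr)
          also have "\<dots> \<le> h j x powr q" using Q h01[of j x] by (intro powr_mono') auto
          finally show ?thesis .
        qed (use Q2 in simp)
      qed auto
      finally show ?thesis .
    qed
    have hstep1: "h (Suc j) x \<le> 2 ^ Q * h j x powr q" for j x
    proof -
      have "h (Suc j) x powr 1 \<le> h (Suc j) x powr (1 / 2)" using h01 by (intro powr_mono') auto
      then show ?thesis using hstep[of j x] h01[of "Suc j" x] by simp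
    qed
    define Y where "Y = (\<lambda>j. \<integral>x. \<bar>u x\<bar> powr q * h j x powr q \<partial>M)"
    have Yi: "integrable M (\<lambda>x. \<bar>u x\<bar> powr q * h j x powr q)" for j
      by (rule Bochner_Integration.integrable_bound[OF uq]) (use hq1 in \<open>auto simp: mult_left_le\<close>)
    have Y0: "0 \<le> Y j" for j unfolding Y_def by (intro Bochner_Integration.integral_nonneg) auto
    have YJ: "Y j \<le> J" for j
      unfolding Y_def J_def using hq1 by (intro integral_mono[OF Yi uq]) (simp add: mult_left_le)
    \<comment> \<open>The exponent is (1 - \<tau>) s + \<tau> q. Interpolation leaves the step with
      the power \<open>q * \<tau>\<close>, which dominates the power \<open>q\<close> because the
      step is at most 1.\<close>
    have interp: "integrable M (\<lambda>x. \<bar>u x\<bar> powr (p + p / \<kappa>) * h j x powr q)"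
      "(\<integral>x. \<bar>u x\<bar> powr (p + p / \<kappa>) * h j x powr q \<partial>M) \<le> Is powr (1 - \<tau>) * Y j powr \<tau>" for j
    proof -
      have t: "0 < 1 - \<tau>" "1 - \<tau> + \<tau> = 1" using \<tau> by auto
      note Hoelder = Hoelder_interpolation[OF us Yi _ _ t(1) \<tau>0 t(2), of j]
      have le: "\<bar>u x\<bar> powr (p + p / \<kappa>) * h j x powr q
          \<le> (\<bar>u x\<bar> powr s) powr (1 - \<tau>) * (\<bar>u x\<bar> powr q * h j x powr q) powr \<tau>" for x
      proof -
        have "(\<bar>u x\<bar> powr s) powr (1 - \<tau>) * (\<bar>u x\<bar> powr q * h j x powr q) powr \<tau>
          = \<bar>u x\<bar> powr (p + p / \<kappa>) * h j x powr (q * \<tau>)"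
          unfolding exponent s_def[symmetric]
          by (simp add: powr_mult powr_powr powr_add mult.commute[of \<tau>] mult.commute[of "1 - \<tau>"] mult.assoc)
        moreover have "h j x powr q \<le> h j x powr (q * \<tau>)"
          using h01 q0 \<tau> by (intro powr_mono') (auto simp: mult_left_le)
        ultimately show ?thesis by (simp add: mult_left_mono)
      qed
      show i: "integrable M (\<lambda>x. \<bar>u x\<bar> powr (p + p / \<kappa>) * h j x powr q)"
        by (rule Bochner_Integration.integrable_bound[OF Hoelder(1)]) (use le in auto)
      show "(\<integral>x. \<bar>u x\<bar> powr (p + p / \<kappa>) * h j x powr q \<partial>M) \<le> Is powr (1 - \<tau>) * Y j powr \<tau>"
        using order_trans[OF integral_mono[OF i Hoelder(1) le] Hoelder(2)] unfolding Is_def Y_def by simp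
    qed
    have recursion: "Y (Suc j) \<le> K * B ^ j * Y j powr (1 + \<alpha>)" for j
    proof -
      let ?m = "mm (Suc j)"
      have mq: "q - p \<le> 2 * real ?m" and mk: "p / \<kappa> \<le> real ?m" and m1: "1 \<le> ?m"
        using m0 mm_ge[of "Suc j"] by auto
      note energy = soft_step_energy[OF ws g_smooth gb g0 \<delta> bB _ _ mq, folded h_def]
      let ?U = "\<integral>x. \<bar>u x\<bar> powr q * h (Suc j) x \<partial>M"
      let ?V = "\<integral>x. h (Suc j) x * (\<bar>u x\<bar> * norm (b x)) powr p \<partial>M"
      have Ui: "integrable M (\<lambda>x. \<bar>u x\<bar> powr q * h (Suc j) x)"
        by (rule Bochner_Integration.integrable_bound[OF uq]) (use h01 in \<open>auto simp: mult_left_le\<close>)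
      have "?U \<le> (\<integral>x. 2 ^ Q * (\<bar>u x\<bar> powr q * h j x powr q) \<partial>M)"
      proof (rule integral_mono[OF Ui])
        show "\<bar>u x\<bar> powr q * h (Suc j) x \<le> 2 ^ Q * (\<bar>u x\<bar> powr q * h j x powr q)" for x
          using mult_left_mono[OF hstep1[of j x] powr_ge_zero[of "\<bar>u x\<bar>" q]] by (simp add: mult_ac)
      qed (use Yi in simp)
      also have "\<dots> = 2 ^ Q * Y j" unfolding Y_def by simp
      \<comment> \<open>The a priori bound \<open>Y j \<le> J\<close> trades the linear bound for
        the power \<tau>, so that both terms take the same form.\<close>
      also have "\<dots> \<le> 2 ^ Q * (J powr (1 - \<tau>) * Y j powr \<tau>)"
      proof -
        have "Y j = Y j powr (1 - \<tau>) * Y j powr \<tau>" using Y0 by (simp add: powr_add[symmetric])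
        also have "\<dots> \<le> J powr (1 - \<tau>) * Y j powr \<tau>"
          using Y0 YJ \<tau> by (intro mult_right_mono powr_mono2) auto
        finally show ?thesis by simp
      qed
      finally have U: "?U \<le> 2 ^ Q * (J powr (1 - \<tau>) * Y j powr \<tau>)" .
      have "?V \<le> (\<integral>x. \<kappa> powr p * 2 ^ Q * (\<bar>u x\<bar> powr (p + p / \<kappa>) * h j x powr q) \<partial>M)"
      proof (rule integral_mono)
        show "integrable M (\<lambda>x. h (Suc j) x * (\<bar>u x\<bar> * norm (b x)) powr p)"
          unfolding h_def by (rule energy(1)[unfolded h_def]) auto
        fix x
        have "h (Suc j) x * (\<bar>u x\<bar> * norm (b x)) powr p \<le> h (Suc j) x * (\<bar>u x\<bar> powr p * (\<kappa> powr p * g x powr (p / \<kappa>)))"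
          using bg[of x] h01 by (simp add: powr_mult mult_left_mono)
        also have "\<dots> = \<kappa> powr p * \<bar>u x\<bar> powr p * (h (Suc j) x * g x powr (p / \<kappa>))" by simp
        also have "\<dots> \<le> \<kappa> powr p * \<bar>u x\<bar> powr p * (h (Suc j) x powr (1 / 2) * \<bar>u x\<bar> powr (p / \<kappa>))"
          unfolding h_def using p0 \<kappa> gpos mk m1 by (intro mult_left_mono soft_step_half_power) auto
        also have "\<dots> \<le> \<kappa> powr p * \<bar>u x\<bar> powr p * ((2 ^ Q * h j x powr q) * \<bar>u x\<bar> powr (p / \<kappa>))"
          using hstep by (intro mult_left_mono mult_right_mono) auto
        also have "\<dots> = \<kappa> powr p * 2 ^ Q * (\<bar>u x\<bar> powr (p + p / \<kappa>) * h j x powr q)"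
          by (simp add: powr_add)
        finally show "h (Suc j) x * (\<bar>u x\<bar> * norm (b x)) powr p
          \<le> \<kappa> powr p * 2 ^ Q * (\<bar>u x\<bar> powr (p + p / \<kappa>) * h j x powr q)" .
      qed (use interp(1) in simp)
      also have "\<dots> \<le> \<kappa> powr p * 2 ^ Q * (Is powr (1 - \<tau>) * Y j powr \<tau>)"
        using interp(2)[of j] by (simp add: mult_left_mono)
      finally have "?U + ?V \<le> 2 ^ Q * (E * Y j powr \<tau>)"
        using U unfolding E_def by (simp add: algebra_simps)
      also have "\<dots> \<le> 2 ^ Q * ((E + 1) * Y j powr \<tau>)"
        by (intro mult_left_mono mult_right_mono) auto
      finally have UV: "?U + ?V \<le> 2 ^ Q * ((E + 1) * Y j powr \<tau>)" .
      have "1 + 2 * real ?m \<le> (1 + 2 * real m0 * Q) * real Q ^ j"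
      proof -
        have "1 \<le> real Q ^ j" using Q2 by (intro one_le_power) auto
        then show ?thesis unfolding mm_def by (simp add: algebra_simps)
      qed
      then have "(1 + 2 * real ?m) powr (p + 1) \<le> ((1 + 2 * real m0 * Q) * real Q ^ j) powr (p + 1)"
        using p0 by (intro powr_mono2) auto
      also have "\<dots> = (1 + 2 * real m0 * Q) powr (p + 1) * (real Q ^ j) powr (p + 1)"
        by (simp add: powr_mult)
      finally have m_le: "(1 + 2 * real ?m) powr (p + 1) \<le> (1 + 2 * real m0 * Q) powr (p + 1) * (real Q ^ j) powr (p + 1)" .
      have "Y (Suc j) \<le> C0 * (4 powr p * (1 + 2 * real ?m) powr (p + 1) * (?U + ?V)) powr (q / p)"
        unfolding Y_def h_def by (rule energy(2)[unfolded h_def]) auto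
      also have "\<dots> \<le> C0 * (4 powr p * ((1 + 2 * real m0 * Q) powr (p + 1) * (real Q ^ j) powr (p + 1))
          * (2 ^ Q * ((E + 1) * Y j powr \<tau>))) powr (q / p)"
        using C0_pos p0 q0 h01
        by (intro mult_left_mono powr_mono2 mult_mono UV m_le mult_nonneg_nonneg add_nonneg_nonneg
            Bochner_Integration.integral_nonneg) auto
      also have "4 powr p * ((1 + 2 * real m0 * Q) powr (p + 1) * (real Q ^ j) powr (p + 1))
          * (2 ^ Q * ((E + 1) * Y j powr \<tau>))
        = (4 powr p * (1 + 2 * real m0 * Q) powr (p + 1) * (2 ^ Q * (E + 1))) * ((real Q ^ j) powr (p + 1) * Y j powr \<tau>)"
        by simp
      also have "C0 * \<dots> powr (q / p) = K * (((real Q ^ j) powr (p + 1)) powr (q / p) * (Y j powr \<tau>) powr (q / p))"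
        unfolding K_def using E0 by (simp add: powr_mult)
      also have "((real Q ^ j) powr (p + 1)) powr (q / p) = B ^ j"
        unfolding B_def using Q2 by (simp add: powr_realpow[symmetric] powr_powr mult.commute mult.left_commute)
      also have "(Y j powr \<tau>) powr (q / p) = Y j powr (1 + \<alpha>)"
        unfolding \<alpha>_def by (simp add: powr_powr)
      finally show ?thesis by simp
    qed
    have init: "Y 0 \<le> \<eta>"
    proof -
      have "Y 0 \<le> (\<integral>x. \<bar>u x\<bar> powr q * soft_step m0 (u x * N x powr (\<kappa> / 2) / k) powr q \<partial>M)"
        unfolding Y_def
      proof (rule integral_mono[OF Yi])
        show "integrable M (\<lambda>x. \<bar>u x\<bar> powr q * soft_step m0 (u x * N x powr (\<kappa> / 2) / k) powr q)"
          by (rule soft_step_powr_integrable(1)[OF uq]) auto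
        fix x
        have "\<bar>u x / g x\<bar> \<le> \<bar>u x * N x powr (\<kappa> / 2) / k\<bar>"
        proof -
          have "k * N x powr (- \<kappa> / 2) \<le> g x" unfolding g_def using \<delta> k1 by simp
          moreover have "0 < k * N x powr (- \<kappa> / 2)" using k1 N1[of x] by (intro mult_pos_pos) auto
          ultimately have "\<bar>u x\<bar> / g x \<le> \<bar>u x\<bar> / (k * N x powr (- \<kappa> / 2))"
            using gpos[of x] by (intro divide_left_mono mult_pos_pos[OF gpos]) auto
          also have "\<dots> = \<bar>u x\<bar> * N x powr (\<kappa> / 2) / k"
          proof -
            have "N x powr (- \<kappa> / 2) = 1 / N x powr (\<kappa> / 2)"
              using powr_minus_divide[of "N x" "\<kappa> / 2"] by simp
            then show ?thesis by simp
          qed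
          finally show ?thesis using gpos[of x] k1 by (simp add: abs_mult abs_divide)
        qed
        then have "h 0 x \<le> soft_step m0 (u x * N x powr (\<kappa> / 2) / k)"
          unfolding h_def mm_def by (simp add: soft_step_mono)
        then show "\<bar>u x\<bar> powr q * h 0 x powr q \<le> \<bar>u x\<bar> powr q * soft_step m0 (u x * N x powr (\<kappa> / 2) / k) powr q"
          using h01 q0 by (intro mult_left_mono powr_mono2) auto
      qed
      then show ?thesis using n by simp
    qed
    have Y_le: "Y j \<le> \<eta> * r ^ j" for j
      by (rule superlinear_recursion[OF Y0 recursion _ _ \<alpha>0 r0 _ K\<eta> rB init]) (use K0 B1 \<eta>0 in auto)
    \<comment> \<open>Where g \<le> \<bar>u\<bar> every step is at least 1/2 whatever its order.
      Hence the integral of \<open>?f\<close> is at most 2^q times each \<open>Y j\<close>, and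
      these tend to 0.\<close>
    let ?f = "\<lambda>x. if g x \<le> \<bar>u x\<bar> then \<bar>u x\<bar> powr q else 0"
    have fi: "integrable M ?f" by (rule Bochner_Integration.integrable_bound[OF uq]) auto
    have "(\<integral>x. ?f x \<partial>M) \<le> 2 powr q * (\<eta> * r ^ j)" for j
    proof -
      have "(\<integral>x. ?f x \<partial>M) \<le> (\<integral>x. 2 powr q * (\<bar>u x\<bar> powr q * h j x powr q) \<partial>M)"
      proof (rule integral_mono[OF fi])
        show "integrable M (\<lambda>x. 2 powr q * (\<bar>u x\<bar> powr q * h j x powr q))" using Yi by simp
        show "?f x \<le> 2 powr q * (\<bar>u x\<bar> powr q * h j x powr q)" for x
        proof (cases "g x \<le> \<bar>u x\<bar>")
          case True
          then have "1 \<le> \<bar>u x / g x\<bar>" using gpos[of x] by (simp add: abs_divide)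
          then have "1 \<le> 2 * h j x" using soft_step_ge_half[of "u x / g x" "mm j"] unfolding h_def by simp
          then have "1 \<le> (2 * h j x) powr q" using q0 by (intro ge_one_powr_ge_zero) auto
          then have "1 \<le> 2 powr q * h j x powr q" using h01 by (simp add: powr_mult)
          then show ?thesis
            using True mult_left_mono[of 1 "2 powr q * h j x powr q" "\<bar>u x\<bar> powr q"] by (simp add: mult.left_commute)
        qed simp
      qed
      also have "\<dots> = 2 powr q * Y j" unfolding Y_def by simp
      also have "\<dots> \<le> 2 powr q * (\<eta> * r ^ j)" by (intro mult_left_mono Y_le) auto
      finally show ?thesis .
    qed
    moreover have "(\<lambda>j. 2 powr q * (\<eta> * r ^ j)) \<longlonglongrightarrow> 2 powr q * (\<eta> * 0)"
      using r0 r1 by (intro tendsto_mult tendsto_const LIMSEQ_power_zero) auto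
    ultimately have "(\<integral>x. ?f x \<partial>M) \<le> 2 powr q * (\<eta> * 0)"
      using LIMSEQ_le_const by blast
    then have "(\<integral>x. ?f x \<partial>M) \<le> 0" by simp
    moreover have "0 \<le> (\<integral>x. ?f x \<partial>M)" by (intro Bochner_Integration.integral_nonneg) auto
    ultimately have "(\<integral>x. ?f x \<partial>M) = 0" by simp
    then have "AE x in M. ?f x = 0"
      using integral_nonneg_eq_0_iff_AE[OF fi] by auto
    then show ?thesis
    proof eventually_elim
      case (elim x)
      have "\<not> g x \<le> \<bar>u x\<bar>"
      proof
        assume le: "g x \<le> \<bar>u x\<bar>"
        then have "\<bar>u x\<bar> powr q = 0" using elim by simp
        then show False using le gpos[of x] by simp
      qed
      then show ?case unfolding g_def by simp
    qed
  qed
  then show thesis using that[of k] k1 unfolding N_def by auto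
qed

lemma weak_solution_decay:
  assumes ws: "weak_solution \<Omega> w p q u G"
  obtains k \<kappa> where "0 < k" "p / (q - p) < \<kappa>"
    "AE x in lebesgue. x \<in> \<Omega> \<and> norm x \<ge> 1 \<longrightarrow> \<bar>u x\<bar> \<le> k / norm x powr \<kappa>"
proof -
  have p0: "0 < p" and q0: "0 < q" using p1 pq by auto
  \<comment> \<open>The midpoint of the admissible interval from p/q to 1; the resulting exponent is
    q - (q - p)/(4p).\<close>
  define \<tau> where "\<tau> = (1 + p / q) / 2"
  have \<tau>: "p / q < \<tau>" "\<tau> < 1" unfolding \<tau>_def using p0 q0 pq by (auto simp: field_simps)
  define q' where "q' = (1 - \<tau>) * (q - q / (2 * p)) + \<tau> * q"
  have q'_eq: "q' = q - (q - p) / (4 * p)"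
    unfolding q'_def \<tau>_def using p0 q0 by (simp add: field_simps)
  have "(q - p) / (4 * p) < (q - p) / 1"
    using p1 pq by (intro divide_strict_left_mono) auto
  then have q': "p < q'" "q' < q"
    unfolding q'_eq using p0 pq by auto
  \<comment> \<open>The solution of \<open>p + p / \<kappa> = q'\<close>; the strict inequality q' <
    q becomes a rate strictly above p/(q - p).\<close>
  define \<kappa> where "\<kappa> = p / (q' - p)"
  have \<kappa>: "0 < \<kappa>" "p / (q - p) < \<kappa>"
    unfolding \<kappa>_def using p0 q' by (auto intro!: divide_strict_left_mono)
  have "p + p / \<kappa> = q'" unfolding \<kappa>_def using p0 q' by simp
  then have exponent: "p + p / \<kappa> = (1 - \<tau>) * (q - q / (2 * p)) + \<tau> * q"
    unfolding q'_def .
  obtain k where k: "0 < k"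
    and floor: "\<And>\<delta>. 0 < \<delta> \<Longrightarrow> AE x in M. \<bar>u x\<bar> \<le> k * ((1 + x \<bullet> x) powr (- \<kappa> / 2) + \<delta>)"
    using decay_with_floor[OF ws \<kappa>(1) \<tau> exponent] by blast
  \<comment> \<open>Countably many floors share one exceptional null set, so at each remaining point
    the floor can be sent to 0.\<close>
  have "AE x in M. \<forall>n. \<bar>u x\<bar> \<le> k * ((1 + x \<bullet> x) powr (- \<kappa> / 2) + inverse (real (Suc n)))"
    unfolding AE_all_countable using floor by simp
  then have "AE x in M. norm x \<ge> 1 \<longrightarrow> \<bar>u x\<bar> \<le> k / norm x powr \<kappa>"
  proof eventually_elim
    case (elim x)
    show ?case
    proof
      assume x: "1 \<le> norm x"
      let ?N = "1 + x \<bullet> x"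
      have "(\<lambda>n. k * (?N powr (- \<kappa> / 2) + inverse (real (Suc n)))) \<longlonglongrightarrow> k * (?N powr (- \<kappa> / 2) + 0)"
        by (intro tendsto_mult tendsto_add tendsto_const LIMSEQ_inverse_real_of_nat)
      then have "\<bar>u x\<bar> \<le> k * (?N powr (- \<kappa> / 2) + 0)"
        using LIMSEQ_le_const elim by blast
      also have "\<dots> \<le> k * (norm x powr 2) powr (- \<kappa> / 2)"
      proof -
        have "norm x powr 2 \<le> ?N" using x by (simp add: powr_numeral power2_norm_eq_inner)
        then have "?N powr (- \<kappa> / 2) \<le> (norm x powr 2) powr (- \<kappa> / 2)"
          using x \<kappa>(1) by (intro powr_mono2') auto
        then show ?thesis using k by simp
      qed
      also have "(norm x powr 2) powr (- \<kappa> / 2) = norm x powr - \<kappa>"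
        unfolding powr_powr by simp
      also have "k * norm x powr - \<kappa> = k / norm x powr \<kappa>"
        unfolding powr_minus_divide by simp
      finally show "\<bar>u x\<bar> \<le> k / norm x powr \<kappa>" .
    qed
  qed
  then have "AE x in lebesgue. x \<in> \<Omega> \<and> norm x \<ge> 1 \<longrightarrow> \<bar>u x\<bar> \<le> k / norm x powr \<kappa>"
    unfolding AE_M by eventually_elim auto
  then show thesis using that k \<kappa>(2) by blast
qed

end

theorem theorem1p6:
  fixes \<Omega> :: "'a::euclidean_space set" and w :: "'a \<Rightarrow> real"
    and p q :: real and u :: "'a \<Rightarrow> real" and G :: "'a \<Rightarrow> 'a"
  assumes "open \<Omega>"
    and "is_weight \<Omega> w"
    and "doubling \<Omega> w"
    and "poincare \<Omega> w p"
    and "1 < p" and "p < dim_w \<Omega> w"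
    and "q = dim_w \<Omega> w * p / (dim_w \<Omega> w - p)"
    and "sobolev_ineq \<Omega> w p q"
    and "weak_solution \<Omega> w p q u G"
  shows "\<exists>R C lam. R > 0 \<and> C > 0 \<and> lam > 0 \<and>
           (AE x in lebesgue. x \<in> \<Omega> \<and> norm x \<ge> R \<longrightarrow>
              \<bar>u x\<bar> \<le> C / norm x powr ((dim_w \<Omega> w - p) / p + lam))"
proof -
  let ?D = "dim_w \<Omega> w"
  have qp: "q - p = p * p / (?D - p)"
    using assms(6) unfolding assms(7) by (simp add: field_simps)
  then have pq: "p < q" using assms(5,6) by (smt (verit) divide_pos_pos mult_pos_pos)
  have exponent: "(?D - p) / p = p / (q - p)" unfolding qp using assms(5) by simp
  obtain S where "0 < S" "\<And>u. test_fun \<Omega> u \<Longrightarrow>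
      S * (LINT x:\<Omega>|lebesgue. \<bar>u x\<bar> powr q * w x) powr (1 / q)
        \<le> (LINT x:\<Omega>|lebesgue. norm (grad u x) powr p * w x) powr (1 / p)"
    using assms(8) unfolding sobolev_ineq_def by blast
  then interpret weighted_sobolev \<Omega> w p q S
    using assms(1,2,5) pq by unfold_locales auto
  obtain k \<kappa> where k: "0 < k" "p / (q - p) < \<kappa>"
    "AE x in lebesgue. x \<in> \<Omega> \<and> norm x \<ge> 1 \<longrightarrow> \<bar>u x\<bar> \<le> k / norm x powr \<kappa>"
    using weak_solution_decay[OF assms(9)] .
  \<comment> \<open>The critical rate is p/(q - p), and \<open>lam\<close> is the excess of \<kappa>
    over it.\<close>
  show ?thesis
    by (rule exI[of _ 1], rule exI[of _ k], rule exI[of _ "\<kappa> - p / (q - p)"])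
      (use k in \<open>simp add: exponent\<close>)
qed

end
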